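(* Let $k$ be an infinite field, let $m,n$ be positive integers with $n\le m/2$, and let $\tau_1,\tau_2$ be $k$-linear endomorphisms of $k^m$. Let $\rho$ be an idempotent endomorphism of $k^m$ with $\operatorname{im}(\rho)=\operatorname{im}(\tau_2)$. Let $R,T_1,T_2\in k^{m\times m}$ be the matrices of $\rho,\tau_1,\tau_2$ in the canonical basis of $k^m$, let $k[x]=k[x_1,\dots,x_m]$, let $x=(x_1,\dots,x_m)^{\top}$ be viewed as a column vector, and let $I_{\rho\tau_1,\tau_2}\subseteq k[x]$ be the ideal generated by all $2\times 2$ minors of the $m\times 2$ matrix $[\,RT_1x \;\; T_2x\,]$. Put $Y_{\rho\tau_1,\tau_2}=\operatorname{Spec}(k[x]/I_{\rho\tau_1,\tau_2})\subseteq\mathbb{A}^m_k$ and $$U_{\rho\tau_1,\tau_2}=Y_{\rho\tau_1,\tau_2}\setminus\Big(\overline{\ker(\rho\tau_1-\tau_2)}\cup\overline{\ker(\rho\tau_1)}\cup\overline{\ker(\tau_2)}\Big).$$ Suppose that $\dim U_{\rho\tau_1,\tau_2}\le m-n$, $\dim_k\operatorname{im}(\tau_2)\ge 2n$ and $\dim_k\operatorname{im}(\tau_1)\ge n$. Then there is a dense open set $\mathscr{U}\subseteq\operatorname{Gr}(n,m)$ such that for every $V\in\mathscr{U}$ and all $v_1,v_2\in V$, the equality $\tau_1(v_1)=\tau_2(v_2)$ implies $v_1=v_2$.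
   Context: For a $k$-subspace $V\subseteq k^m$, $I_V\subseteq k[x]$ denotes the ideal of polynomials vanishing on $V$ and $\overline{V}=\operatorname{Spec}(k[x]/I_V)$ is the corresponding closed subscheme of $\mathbb{A}^m_k=\operatorname{Spec}(k[x])$; thus $U_{\rho\tau_1,\tau_2}$ is an open subscheme of $Y_{\rho\tau_1,\tau_2}$ (a locally closed subscheme of $\mathbb{A}^m_k$), and $\dim$ denotes its (Krull) dimension. $\operatorname{Gr}(n,m)$ is the Grassmannian of $n$-dimensional $k$-subspaces of $k^m$ with its Zariski topology. *)

theory Defs
  imports
    "HOL-Analysis.Analysis"
    "HOL-Library.Poly_Mapping"
    "HOL-Algebra.Algebraic_Closure_Type"
begin

no_notation fps_nth (infixl \<open>$\<close> 75)

subsection \<open>Krull dimension of a topological space\<close>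

definition irreducible_closedin :: "'a topology \<Rightarrow> 'a set \<Rightarrow> bool" where
  "irreducible_closedin T Z \<longleftrightarrow>
     closedin T Z \<and> Z \<noteq> {} \<and>
     (\<forall>A B. closedin T A \<longrightarrow> closedin T B \<longrightarrow> Z = A \<union> B \<longrightarrow> Z = A \<or> Z = B)"

text \<open>The supremum is taken in the extended reals, so the empty space has dimension \<open>-\<infinity>\<close>.\<close>

definition krull_dim :: "'a topology \<Rightarrow> ereal" where
  "krull_dim T = Sup {ereal (real d) | d.
     \<exists>Z :: nat \<Rightarrow> 'a set.
       (\<forall>i\<le>d. irreducible_closedin T (Z i)) \<and> (\<forall>i<d. Z i \<subset> Z (Suc i))}"

subsection \<open>The prime spectrum\<close>

definition prime_spectrum :: "('a, 'b) ring_scheme \<Rightarrow> 'a set set" where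
  "prime_spectrum R = {P. primeideal P R}"

definition spec_zero_set :: "('a, 'b) ring_scheme \<Rightarrow> 'a set \<Rightarrow> 'a set set" where
  "spec_zero_set R S = {P \<in> prime_spectrum R. S \<subseteq> P}"

definition Spec :: "('a, 'b) ring_scheme \<Rightarrow> 'a set topology" where
  "Spec R = topology (\<lambda>W. \<exists>S \<subseteq> carrier R. W = prime_spectrum R - spec_zero_set R S)"

lemma spec_zero_set_Un:
  assumes "cring R" and S: "S \<subseteq> carrier R" and T: "T \<subseteq> carrier R"
  shows "spec_zero_set R S \<union> spec_zero_set R T =
         spec_zero_set R {s \<otimes>\<^bsub>R\<^esub> t | s t. s \<in> S \<and> t \<in> T}" (is "?L = ?R")
proof
  show "?L \<subseteq> ?R"
  proof
    fix P assume "P \<in> ?L"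
    then have P: "primeideal P R" and ST: "S \<subseteq> P \<or> T \<subseteq> P"
      by (auto simp: spec_zero_set_def prime_spectrum_def)
    interpret primeideal P R by (rule P)
    have "s \<otimes>\<^bsub>R\<^esub> t \<in> P" if "s \<in> S" "t \<in> T" for s t
      using that S T ST I_l_closed[of t s] I_r_closed[of s t] by blast
    then show "P \<in> ?R"
      using P by (auto simp: spec_zero_set_def prime_spectrum_def)
  qed
  show "?R \<subseteq> ?L"
  proof
    fix P assume "P \<in> ?R"
    then have P: "primeideal P R" and ST: "\<And>s t. s \<in> S \<Longrightarrow> t \<in> T \<Longrightarrow> s \<otimes>\<^bsub>R\<^esub> t \<in> P"
      by (auto simp: spec_zero_set_def prime_spectrum_def)
    interpret primeideal P R by (rule P)
    have "S \<subseteq> P \<or> T \<subseteq> P"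
      using ST I_prime S T by (meson subset_iff)
    then show "P \<in> ?L"
      using P by (auto simp: spec_zero_set_def prime_spectrum_def)
  qed
qed

lemma istopology_Spec:
  assumes "cring R"
  shows "istopology (\<lambda>W. \<exists>S \<subseteq> carrier R. W = prime_spectrum R - spec_zero_set R S)"
  unfolding istopology_def
proof (intro conjI allI impI)
  fix V W
  assume "\<exists>S \<subseteq> carrier R. V = prime_spectrum R - spec_zero_set R S"
     and "\<exists>S \<subseteq> carrier R. W = prime_spectrum R - spec_zero_set R S"
  then obtain S T where S: "S \<subseteq> carrier R" "V = prime_spectrum R - spec_zero_set R S"
    and T: "T \<subseteq> carrier R" "W = prime_spectrum R - spec_zero_set R T" by blast
  interpret cring R by fact
  let ?ST = "{s \<otimes>\<^bsub>R\<^esub> t | s t. s \<in> S \<and> t \<in> T}"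
  have "V \<inter> W = prime_spectrum R - spec_zero_set R ?ST"
    using spec_zero_set_Un[OF assms S(1) T(1)] S(2) T(2) by blast
  moreover have "?ST \<subseteq> carrier R" using S(1) T(1) by auto
  ultimately show "\<exists>S \<subseteq> carrier R. V \<inter> W = prime_spectrum R - spec_zero_set R S" by blast
next
  fix \<K> assume K: "\<forall>W\<in>\<K>. \<exists>S \<subseteq> carrier R. W = prime_spectrum R - spec_zero_set R S"
  then obtain S where S: "\<And>W. W \<in> \<K> \<Longrightarrow> S W \<subseteq> carrier R"
      "\<And>W. W \<in> \<K> \<Longrightarrow> W = prime_spectrum R - spec_zero_set R (S W)" by metis
  have "P \<in> \<Union>\<K> \<longleftrightarrow> P \<in> prime_spectrum R - spec_zero_set R (\<Union>W\<in>\<K>. S W)" for P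
  proof -
    have "P \<in> W \<longleftrightarrow> P \<in> prime_spectrum R \<and> \<not> S W \<subseteq> P" if "W \<in> \<K>" for W
      using S(2)[OF that] by (auto simp: spec_zero_set_def)
    then show ?thesis by (auto simp: spec_zero_set_def)
  qed
  then have "\<Union>\<K> = prime_spectrum R - spec_zero_set R (\<Union>W\<in>\<K>. S W)" by blast
  moreover have "(\<Union>W\<in>\<K>. S W) \<subseteq> carrier R" using S(1) by blast
  ultimately show "\<exists>S \<subseteq> carrier R. \<Union>\<K> = prime_spectrum R - spec_zero_set R S" by blast
qed

lemma openin_Spec:
  assumes "cring R"
  shows "openin (Spec R) W \<longleftrightarrow> (\<exists>S \<subseteq> carrier R. W = prime_spectrum R - spec_zero_set R S)"
  unfolding Spec_def by (subst topology_inverse'[OF istopology_Spec[OF assms]]) (rule refl)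

subsection \<open>Polynomials in the variables indexed by a finite type\<close>

type_synonym ('i, 'k) mpoly = "('i \<Rightarrow>\<^sub>0 nat) \<Rightarrow>\<^sub>0 'k"

definition mvar :: "'i \<Rightarrow> ('i, 'k::comm_ring_1) mpoly" where
  "mvar i = Poly_Mapping.single (Poly_Mapping.single i 1) 1"

definition mconst :: "'k \<Rightarrow> ('i, 'k::comm_ring_1) mpoly" where
  "mconst c = Poly_Mapping.single 0 c"

definition meval :: "('i::finite \<Rightarrow> 'k) \<Rightarrow> ('i, 'k::comm_ring_1) mpoly \<Rightarrow> 'k" where
  "meval a p = (\<Sum>t\<in>Poly_Mapping.keys p.
     Poly_Mapping.lookup p t * (\<Prod>i\<in>UNIV. a i ^ Poly_Mapping.lookup t i))"

definition homogeneous :: "nat \<Rightarrow> ('i::finite, 'k::comm_ring_1) mpoly \<Rightarrow> bool" where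
  "homogeneous d p \<longleftrightarrow>
     (\<forall>t\<in>Poly_Mapping.keys p. (\<Sum>i\<in>UNIV. Poly_Mapping.lookup t i) = d)"

lemma meval_0 [simp]: "meval a 0 = 0"
  by (simp add: meval_def)

lemma meval_1 [simp]: "meval a 1 = 1"
  by (simp add: meval_def)

lemma meval_add: "meval a (p + q) = meval a p + meval a q"
  unfolding meval_def by (rule setsum_keys_plus_distrib) (auto simp: algebra_simps)

lemma meval_single:
  "meval a (Poly_Mapping.single t c) = c * (\<Prod>i\<in>UNIV. a i ^ Poly_Mapping.lookup t i)"
  by (simp add: meval_def)

lemma mpoly_induct [case_names zero add]:
  assumes "P 0" and "\<And>p t c. P p \<Longrightarrow> P (p + Poly_Mapping.single t c)"
  shows "P p"
proof (induction p rule: update_induct)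
  case const
  show ?case by fact
next
  case (update p t c)
  have "Poly_Mapping.update t c p = p + Poly_Mapping.single t c"
    using update(1)
    by (intro poly_mapping_eqI)
       (auto simp: lookup_update lookup_add lookup_single when_def in_keys_iff)
  then show ?case using assms(2)[OF update(3)] by simp
qed

lemma meval_mult: "meval a (p * q) = meval a p * meval a q"
proof (induction p rule: mpoly_induct)
  case zero
  show ?case by simp
next
  case (add p t c)
  have "meval a (Poly_Mapping.single t c * q) = meval a (Poly_Mapping.single t c) * meval a q"
  proof (induction q rule: mpoly_induct)
    case zero
    show ?case by simp
  next
    case (add q s d)
    then show ?case
      by (simp add: distrib_left meval_add mult_single meval_single lookup_add power_add
          prod.distrib mult_ac)
  qed
  then show ?case using add by (simp add: distrib_right meval_add)
qed

lemma homogeneous_mult: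
  assumes "homogeneous d p" "homogeneous e q"
  shows "homogeneous (d + e) (p * q)"
  unfolding homogeneous_def
proof
  fix t assume "t \<in> Poly_Mapping.keys (p * q)"
  then obtain u v where "t = u + v" "u \<in> Poly_Mapping.keys p" "v \<in> Poly_Mapping.keys q"
    using keys_mult by blast
  then show "(\<Sum>i\<in>UNIV. Poly_Mapping.lookup t i) = d + e"
    using assms by (simp add: homogeneous_def lookup_add sum.distrib)
qed

lemma meval_homogeneous:
  assumes "homogeneous d p"
  shows "meval (\<lambda>i. a i * c) p = meval a p * c ^ d"
proof -
  have "(\<Prod>i\<in>UNIV. c ^ Poly_Mapping.lookup t i) = c ^ d" if "t \<in> Poly_Mapping.keys p" for t
    using assms that by (simp add: homogeneous_def power_sum[symmetric])
  then show ?thesis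
    unfolding meval_def sum_distrib_right
    by (intro sum.cong refl) (simp add: power_mult_distrib prod.distrib)
qed

abbreviation mpoly_ring :: "('i, 'k::comm_ring_1) mpoly ring" where
  "mpoly_ring \<equiv> ring_of_type_algebra"

definition vanishing_ideal :: "('k::field ^ 'm) set \<Rightarrow> ('m::finite, 'k) mpoly set" where
  "vanishing_ideal V = {p. \<forall>v\<in>V. meval (\<lambda>i. v $ i) p = 0}"

subsection \<open>The Zariski topology on the Grassmannian\<close>

definition Gr :: "'n::finite itself \<Rightarrow> ('k::field ^ 'm) set set" where
  "Gr (_ :: 'n itself) = {V. vec.subspace V \<and> vec.dim V = CARD('n)}"

text \<open>
  The homogeneous coordinates of the Pluecker embedding, for a matrix whose columns form a basis
  of the subspace. They are indexed by all \<open>n\<close>-tuples of row indices instead of the increasing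
  ones: the extra coordinates are zero or agree up to sign with one of the others.
\<close>

definition pluecker :: "'k::field ^ 'n ^ 'm \<Rightarrow> ('n::finite \<Rightarrow> 'm::finite) \<Rightarrow> 'k" where
  "pluecker B s = det (\<chi> i. B $ s i)"

definition Gr_zero_set :: "('n::finite \<Rightarrow> 'm::finite, 'k::field) mpoly set \<Rightarrow> ('k ^ 'm) set set"
  where "Gr_zero_set S = {V \<in> Gr TYPE('n).
     \<forall>F\<in>S. \<forall>B :: 'k ^ 'n ^ 'm. vec.span (columns B) = V \<longrightarrow> meval (pluecker B) F = 0}"

definition Gr_zariski :: "'n::finite itself \<Rightarrow> ('k::field ^ 'm::finite) set topology" where
  "Gr_zariski (_ :: 'n itself) = topology (\<lambda>W.
     \<exists>S :: ('n \<Rightarrow> 'm, 'k) mpoly set.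
       (\<forall>F\<in>S. \<exists>d. homogeneous d F) \<and> W = Gr TYPE('n) - Gr_zero_set S)"

lemma pluecker_mult: "pluecker (B ** A) s = pluecker B s * det A"
proof -
  have "(\<chi> i. (B ** A) $ s i) = (\<chi> i. B $ s i) ** A"
    by (simp add: vec_eq_iff matrix_matrix_mult_def)
  then show ?thesis by (simp add: pluecker_def det_mul)
qed

lemma columns_change_of_basis:
  fixes B C :: "'k::field ^ 'n::finite ^ 'm::finite"
  assumes "columns C \<subseteq> vec.span (columns B)"
  obtains A where "C = B ** A"
proof -
  have "column i B = B *v axis i 1" for i
    by (simp add: vec_eq_iff column_def matrix_vector_mult_def axis_def if_distrib cong: if_cong)
  then have "columns B \<subseteq> range ((*v) B)"
    by (auto simp: columns_def)
  moreover have "vec.subspace (range ((*v) B))"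
    using vec.subspace_image[OF vec.subspace_UNIV] by blast
  ultimately have "vec.span (columns B) \<subseteq> range ((*v) B)"
    by (rule vec.span_minimal)
  with assms have "\<forall>j. \<exists>x. column j C = B *v x"
    by (auto simp: columns_def)
  then obtain x where x: "\<And>j. column j C = B *v x j" by metis
  have "C = B ** (\<chi> i j. x j $ i)"
    using x by (simp add: vec_eq_iff column_def matrix_matrix_mult_def matrix_vector_mult_def)
  then show thesis by (rule that)
qed

lemma Gr_zero_set_Un:
  fixes S T :: "('n::finite \<Rightarrow> 'm::finite, 'k::field) mpoly set"
  assumes S: "\<And>F. F \<in> S \<Longrightarrow> \<exists>d. homogeneous d F" and T: "\<And>F. F \<in> T \<Longrightarrow> \<exists>d. homogeneous d F"
  shows "Gr_zero_set S \<union> Gr_zero_set T = Gr_zero_set {F * G | F G. F \<in> S \<and> G \<in> T}"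
    (is "?L = ?R")
proof
  show "?L \<subseteq> ?R"
    by (auto simp: Gr_zero_set_def meval_mult)
  show "?R \<subseteq> ?L"
  proof
    fix V assume V: "V \<in> ?R"
    show "V \<in> ?L"
    proof (rule ccontr)
      assume "V \<notin> ?L"
      with V obtain F G and B C :: "'k ^ 'n ^ 'm" where
        F: "F \<in> S" "vec.span (columns B) = V" "meval (pluecker B) F \<noteq> 0" and
        G: "G \<in> T" "vec.span (columns C) = V" "meval (pluecker C) G \<noteq> 0"
        by (auto simp: Gr_zero_set_def)
      have "columns C \<subseteq> vec.span (columns B)"
        using F(2) G(2) vec.span_superset[of "columns C"] by simp
      then obtain A where "C = B ** A" by (rule columns_change_of_basis)
      then have "pluecker C = (\<lambda>s. pluecker B s * det A)" by (simp add: fun_eq_iff pluecker_mult)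
      moreover obtain d where "homogeneous d G" using T G(1) by blast
      ultimately have "meval (pluecker B) G \<noteq> 0"
        using G(3) by (auto simp: meval_homogeneous)
      then have "meval (pluecker B) (F * G) \<noteq> 0" using F(3) by (simp add: meval_mult)
      then show False using V F(1,2) G(1) by (auto simp: Gr_zero_set_def)
    qed
  qed
qed

lemma istopology_Gr_zariski:
  "istopology (\<lambda>W. \<exists>S :: ('n::finite \<Rightarrow> 'm::finite, 'k::field) mpoly set.
     (\<forall>F\<in>S. \<exists>d. homogeneous d F) \<and> W = Gr TYPE('n) - Gr_zero_set S)" (is "istopology ?O")
  unfolding istopology_def
proof (intro conjI allI impI)
  fix V W assume "?O V" "?O W"
  then obtain S T :: "('n \<Rightarrow> 'm, 'k) mpoly set"
    where S: "\<And>F. F \<in> S \<Longrightarrow> \<exists>d. homogeneous d F" "V = Gr TYPE('n) - Gr_zero_set S"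
      and T: "\<And>F. F \<in> T \<Longrightarrow> \<exists>d. homogeneous d F" "W = Gr TYPE('n) - Gr_zero_set T" by blast
  let ?ST = "{F * G | F G. F \<in> S \<and> G \<in> T}"
  have "V \<inter> W = Gr TYPE('n) - Gr_zero_set ?ST"
    using Gr_zero_set_Un[of S T] S T by auto
  moreover have "\<forall>F\<in>?ST. \<exists>d. homogeneous d F"
    using S(1) T(1) homogeneous_mult by blast
  ultimately show "?O (V \<inter> W)" by blast
next
  fix \<K> assume K: "\<forall>W\<in>\<K>. ?O W"
  then obtain S :: "('k ^ 'm) set set \<Rightarrow> ('n \<Rightarrow> 'm, 'k) mpoly set"
    where S: "\<And>W F. W \<in> \<K> \<Longrightarrow> F \<in> S W \<Longrightarrow> \<exists>d. homogeneous d F"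
      "\<And>W. W \<in> \<K> \<Longrightarrow> W = Gr TYPE('n) - Gr_zero_set (S W)" by metis
  have "Gr_zero_set (\<Union>W\<in>\<K>. S W) = {V \<in> Gr TYPE('n). \<forall>W\<in>\<K>. V \<in> Gr_zero_set (S W)}"
    by (auto simp: Gr_zero_set_def)
  then have "\<Union>\<K> = Gr TYPE('n) - Gr_zero_set (\<Union>W\<in>\<K>. S W)"
    using S(2) by blast
  moreover have "\<forall>F\<in>(\<Union>W\<in>\<K>. S W). \<exists>d. homogeneous d F" using S(1) by blast
  ultimately show "?O (\<Union>\<K>)" by blast
qed

lemma openin_Gr_zariski:
  "openin (Gr_zariski TYPE('n::finite)) W \<longleftrightarrow>
     (\<exists>S :: ('n \<Rightarrow> 'm::finite, 'k::field) mpoly set.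
       (\<forall>F\<in>S. \<exists>d. homogeneous d F) \<and> W = Gr TYPE('n) - Gr_zero_set S)"
  unfolding Gr_zariski_def by (subst topology_inverse'[OF istopology_Gr_zariski]) (rule refl)

lemma topspace_Gr_zariski:
  "topspace (Gr_zariski TYPE('n::finite) :: ('k::field ^ 'm::finite) set topology) = Gr TYPE('n)"
proof -
  have ex: "\<exists>B :: 'k ^ 'n ^ 'm. vec.span (columns B) = V" if V: "V \<in> Gr TYPE('n)"
    for V :: "('k ^ 'm) set"
  proof -
    obtain E where E: "E \<subseteq> V" "vec.independent E" "V \<subseteq> vec.span E" "card E = vec.dim V"
      using vec.basis_exists by blast
    have "vec.span E = V"
      using E V vec.span_minimal[OF E(1)] by (auto simp: Gr_def)
    moreover obtain f where f: "bij_betw f (UNIV :: 'n set) E"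
      using E V vec.finiteI_independent finite_same_card_bij[of "UNIV :: 'n set" E]
      by (auto simp: Gr_def)
    moreover have "columns (\<chi> i j. f j $ i) = E"
      using f by (auto simp: columns_def column_def bij_betw_def)
    ultimately show ?thesis by metis
  qed
  have "homogeneous 0 (1 :: ('n \<Rightarrow> 'm, 'k) mpoly)" by (auto simp: homogeneous_def)
  moreover have "Gr_zero_set {1 :: ('n \<Rightarrow> 'm, 'k) mpoly} = {}"
    using ex by (auto simp: Gr_zero_set_def)
  ultimately have "openin (Gr_zariski TYPE('n)) (Gr TYPE('n) :: ('k ^ 'm) set set)"
    unfolding openin_Gr_zariski by (intro exI[of _ "{1}"]) auto
  then show ?thesis
    using openin_subset openin_topspace openin_Gr_zariski by (metis Diff_subset subset_antisym)
qed

subsection \<open>The determinantal locus\<close>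

text \<open>The two rows are chosen in either order, so each minor occurs with both signs.\<close>

definition minors2 :: "'a::comm_ring_1 ^ 2 ^ 'm \<Rightarrow> 'a set" where
  "minors2 M = {det (\<chi> i. M $ s i) | s :: 2 \<Rightarrow> 'm. inj s}"

text \<open>The \<open>m \<times> 2\<close> matrix \<open>[Ax  Bx]\<close> of linear forms.\<close>

definition pencil_matrix ::
    "'k::field ^ 'm ^ 'm \<Rightarrow> 'k ^ 'm ^ 'm \<Rightarrow> ('m::finite, 'k) mpoly ^ 2 ^ 'm" where
  "pencil_matrix A B = (let x = (\<chi> i. mvar i) in
     \<chi> i j. if j = 1 then (map_matrix mconst A *v x) $ i else (map_matrix mconst B *v x) $ i)"

definition minors_ideal :: "'k::field ^ 'm ^ 'm \<Rightarrow> 'k ^ 'm ^ 'm \<Rightarrow> ('m::finite, 'k) mpoly set" where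
  "minors_ideal A B = Idl\<^bsub>mpoly_ring\<^esub> (minors2 (pencil_matrix A B))"

text \<open>
  The spectrum of \<open>k[x]/I\<close> is identified with the closed subset of the spectrum of \<open>k[x]\<close>
  of the primes containing \<open>I\<close>; dimension only depends on the underlying topological space.
\<close>

definition Y_locus ::
    "('k::field ^ 'm \<Rightarrow> 'k ^ 'm) \<Rightarrow> ('k ^ 'm \<Rightarrow> 'k ^ 'm) \<Rightarrow> ('k ^ 'm \<Rightarrow> 'k ^ 'm)
     \<Rightarrow> ('m::finite, 'k) mpoly set set" where
  "Y_locus \<rho> \<tau>1 \<tau>2 = spec_zero_set mpoly_ring (minors_ideal (matrix \<rho> ** matrix \<tau>1) (matrix \<tau>2))"

definition subspace_closure :: "('k::field ^ 'm) set \<Rightarrow> ('m::finite, 'k) mpoly set set" where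
  "subspace_closure V = spec_zero_set mpoly_ring (vanishing_ideal V)"

definition U_locus ::
    "('k::field ^ 'm \<Rightarrow> 'k ^ 'm) \<Rightarrow> ('k ^ 'm \<Rightarrow> 'k ^ 'm) \<Rightarrow> ('k ^ 'm \<Rightarrow> 'k ^ 'm)
     \<Rightarrow> ('m::finite, 'k) mpoly set set" where
  "U_locus \<rho> \<tau>1 \<tau>2 = Y_locus \<rho> \<tau>1 \<tau>2 -
     (subspace_closure {v. \<rho> (\<tau>1 v) - \<tau>2 v = 0} \<union>
      subspace_closure {v. \<rho> (\<tau>1 v) = 0} \<union>
      subspace_closure {v. \<tau>2 v = 0})"

end

theory Submission
  imports Defs "HOL-Library.Function_Algebras"
begin

text \<open>
  A subset of affine space is called thin if it lies in a proper Zariski-closed subset. Counting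
  monomials, the image of a polynomial map from \<open>r\<close> parameters to an affine space of dimension
  \<open>N > r\<close> is thin. The \<open>m \<times> n\<close> matrices \<open>M\<close> whose column space contains \<open>v\<^sub>1 \<noteq> v\<^sub>2\<close> with
  \<open>\<tau>\<^sub>1 v\<^sub>1 = \<tau>\<^sub>2 v\<^sub>2\<close> are covered by finitely many such images with at most \<open>mn - 1\<close> parameters: if \<open>v\<^sub>1, v\<^sub>2\<close>
  are independent, the pair lies in a linear space of dimension at most \<open>2m - 2n\<close>; otherwise
  \<open>v\<^sub>1\<close> is in the kernel of some \<open>\<tau>\<^sub>1 - \<mu>\<tau>\<^sub>2\<close> with \<open>\<mu> \<noteq> 1\<close> (or \<open>v\<^sub>2\<close> is in the kernel of \<open>\<tau>\<^sub>2\<close>), which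
  has dimension at most \<open>m - 2n\<close> for all but finitely many \<open>\<mu>\<close> and at most \<open>m - n\<close> for the others.
  The last bound is where the dimension of the determinantal locus enters: the vanishing ideals of
  a flag of affine subspaces in the kernel of \<open>\<rho>\<tau>\<^sub>1 - \<mu>\<tau>\<^sub>2\<close>, all through one point outside the kernel
  of \<open>\<tau>\<^sub>2\<close>, form a chain of primes in the locus. Finally, a polynomial in the entries of \<open>M\<close> becomes
  a homogeneous polynomial in the Pluecker coordinates on an affine chart of the Grassmannian.
\<close>

section \<open>Polynomial functions\<close>

text \<open>The algebra of functions generated by \<open>J\<close> and the constants. Taking
  functions on an arbitrary type \<open>'p\<close> lets tuples of vectors, scalars and matrices
  serve as parameters; \<open>card J\<close> counts the parameters that are really used.\<close>

inductive_set polyfuns :: "('p \<Rightarrow> 'k::comm_ring_1) set \<Rightarrow> ('p \<Rightarrow> 'k) set" for J where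
  polyfuns_const: "(\<lambda>p. c) \<in> polyfuns J"
| polyfuns_base: "f \<in> J \<Longrightarrow> f \<in> polyfuns J"
| polyfuns_add: "f \<in> polyfuns J \<Longrightarrow> g \<in> polyfuns J \<Longrightarrow> (\<lambda>p. f p + g p) \<in> polyfuns J"
| polyfuns_mult: "f \<in> polyfuns J \<Longrightarrow> g \<in> polyfuns J \<Longrightarrow> (\<lambda>p. f p * g p) \<in> polyfuns J"

lemma polyfuns_minus:
  assumes "f \<in> polyfuns J"
  shows "(\<lambda>p. - f p) \<in> polyfuns J"
  using polyfuns_mult[OF polyfuns_const[of "-1"] assms] by simp

lemma polyfuns_diff:
  assumes "f \<in> polyfuns J" "g \<in> polyfuns J"
  shows "(\<lambda>p. f p - g p) \<in> polyfuns J"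
  using polyfuns_add[OF assms(1) polyfuns_minus[OF assms(2)]] by simp

lemma polyfuns_sum:
  assumes "\<And>i. i \<in> A \<Longrightarrow> f i \<in> polyfuns J"
  shows "(\<lambda>p. \<Sum>i\<in>A. f i p) \<in> polyfuns J"
  using assms
  by (induction A rule: infinite_finite_induct)
     (auto intro: polyfuns_add polyfuns_const)

lemma polyfuns_prod:
  assumes "\<And>i. i \<in> A \<Longrightarrow> f i \<in> polyfuns J"
  shows "(\<lambda>p. \<Prod>i\<in>A. f i p) \<in> polyfuns J"
  using assms
  by (induction A rule: infinite_finite_induct)
     (auto intro: polyfuns_mult polyfuns_const)

lemma polyfuns_power:
  assumes "f \<in> polyfuns J"
  shows "(\<lambda>p. f p ^ n) \<in> polyfuns J"
  by (induction n) (auto intro: polyfuns_mult polyfuns_const assms)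

lemma polyfuns_if:
  assumes "f \<in> polyfuns J" "g \<in> polyfuns J"
  shows "(\<lambda>p. if b then f p else g p) \<in> polyfuns J"
  using assms by (cases b) simp_all

lemmas polyfuns_intros = polyfuns_const polyfuns_add polyfuns_mult polyfuns_minus polyfuns_diff
  polyfuns_sum polyfuns_prod polyfuns_power

lemma polyfuns_det:
  assumes "\<And>i j. (\<lambda>p. M p i j) \<in> polyfuns J"
  shows "(\<lambda>p. det (\<chi> i j. M p i j)) \<in> polyfuns J"
  unfolding det_def by (simp, intro polyfuns_intros assms)

lemma polyfuns_meval:
  assumes "\<And>i. (\<lambda>p. a p i) \<in> polyfuns J"
  shows "(\<lambda>p. meval (a p) G) \<in> polyfuns J"
  unfolding meval_def by (intro polyfuns_intros assms)

lemma polyfuns_comp: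
  assumes "f \<in> polyfuns J" "\<And>g. g \<in> J \<Longrightarrow> (\<lambda>q. g (h q)) \<in> polyfuns K"
  shows "(\<lambda>q. f (h q)) \<in> polyfuns K"
  using assms(1) by induction (auto intro: polyfuns_intros assms(2))

lemma polyfuns_poly:
  assumes "f \<in> polyfuns {\<lambda>t. t}"
  shows "\<exists>P. \<forall>t. f t = poly P t"
  using assms
proof induction
  case (polyfuns_const c)
  show ?case by (rule exI[of _ "[:c:]"]) simp
next
  case (polyfuns_base f)
  then show ?case by (intro exI[of _ "[:0, 1:]"]) simp
next
  case (polyfuns_add f g)
  then show ?case by (metis poly_add)
next
  case (polyfuns_mult f g)
  then show ?case by (metis poly_mult)
qed

text \<open>The product of two nonzero univariate polynomials is nonzero, so its finitely many roots
  do not exhaust an infinite field.\<close>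

lemma polyfuns_line_common_nonzero:
  fixes f g :: "'k::field \<Rightarrow> 'k"
  assumes inf: "infinite (UNIV :: 'k set)"
    and f: "f \<in> polyfuns {\<lambda>t. t}" "f s \<noteq> 0" and g: "g \<in> polyfuns {\<lambda>t. t}" "g s' \<noteq> 0"
  obtains t where "f t \<noteq> 0" "g t \<noteq> 0"
proof -
  obtain P Q where P: "\<And>t. f t = poly P t" and Q: "\<And>t. g t = poly Q t"
    using polyfuns_poly f(1) g(1) by metis
  have "P * Q \<noteq> 0" using f(2) g(2) P Q by auto
  then have "finite {t. poly (P * Q) t = 0}" by (rule poly_roots_finite)
  then obtain t where "poly (P * Q) t \<noteq> 0"
    using inf by (metis (mono_tags) finite_subset mem_Collect_eq subsetI)
  then show thesis using that P Q by auto
qed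

abbreviation coords :: "(('i \<Rightarrow> 'k) \<Rightarrow> 'k) set" where
  "coords \<equiv> range (\<lambda>i x. x i)"

text \<open>On the line through \<open>x\<close> and \<open>y\<close> both functions become
  univariate polynomials, nonzero at the parameters 0 and 1 respectively. This irreducibility of
  affine space serves for unions of thin sets, for density in the Grassmannian and for
  primality.\<close>

lemma polyfuns_common_nonzero:
  fixes f g :: "('i \<Rightarrow> 'k::field) \<Rightarrow> 'k"
  assumes inf: "infinite (UNIV :: 'k set)"
    and f: "f \<in> polyfuns coords" "f x \<noteq> 0" and g: "g \<in> polyfuns coords" "g y \<noteq> 0"
  obtains t where "f (\<lambda>i. x i + t * (y i - x i)) \<noteq> 0" "g (\<lambda>i. x i + t * (y i - x i)) \<noteq> 0"
proof -
  let ?h = "\<lambda>t i. x i + t * (y i - x i)"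
  have h: "(\<lambda>t. c (?h t)) \<in> polyfuns {\<lambda>t. t}" if "c \<in> coords" for c
    using that by (auto intro!: polyfuns_intros intro: polyfuns_base)
  show thesis
    using polyfuns_line_common_nonzero[OF inf, of "\<lambda>t. f (?h t)" 0 "\<lambda>t. g (?h t)" 1] that
      polyfuns_comp[OF f(1), of ?h] polyfuns_comp[OF g(1), of ?h] f(2) g(2) h by auto
qed

section \<open>Kronecker substitution and nonzero values of polynomials\<close>

lemma base_expansion_unique:
  fixes d d' :: "nat \<Rightarrow> nat"
  assumes "\<And>i. i < N \<Longrightarrow> d i < M" "\<And>i. i < N \<Longrightarrow> d' i < M"
    and "(\<Sum>i<N. d i * M ^ i) = (\<Sum>i<N. d' i * M ^ i)" "i < N"
  shows "d i = d' i"
  using assms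
proof (induction N arbitrary: d d' i)
  case 0
  then show ?case by simp
next
  case (Suc N)
  \<comment> \<open>Splitting off the lowest digit: it is the residue modulo \<open>M\<close>, and
    the rest is left to the induction.\<close>
  have *: "(\<Sum>i<Suc N. e i * M ^ i) = e 0 + M * (\<Sum>i<N. e (Suc i) * M ^ i)" for e :: "nat \<Rightarrow> nat"
    by (subst sum.lessThan_Suc_shift) (simp add: sum_distrib_left mult_ac)
  have eq: "d 0 + M * (\<Sum>i<N. d (Suc i) * M ^ i) = d' 0 + M * (\<Sum>i<N. d' (Suc i) * M ^ i)"
    using Suc.prems(3) unfolding * .
  have lt: "d 0 < M" "d' 0 < M" using Suc.prems(1,2) by auto
  have "(d 0 + M * (\<Sum>i<N. d (Suc i) * M ^ i)) mod M = d 0"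
    "(d' 0 + M * (\<Sum>i<N. d' (Suc i) * M ^ i)) mod M = d' 0"
    using lt by auto
  then have 0: "d 0 = d' 0" using eq by simp
  show ?case
  proof (cases i)
    case 0
    then show ?thesis using \<open>d 0 = d' 0\<close> by simp
  next
    case (Suc j)
    have "(\<Sum>i<N. d (Suc i) * M ^ i) = (\<Sum>i<N. d' (Suc i) * M ^ i)"
      using eq 0 lt by simp
    then show ?thesis
      using Suc.IH[of "\<lambda>i. d (Suc i)" "\<lambda>i. d' (Suc i)" j] Suc.prems Suc by auto
  qed
qed

lemma mpoly_nonzero_point:
  fixes G :: "('i::finite, 'k::field) mpoly"
  assumes inf: "infinite (UNIV :: 'k set)" and G: "G \<noteq> 0"
  obtains x where "meval x G \<noteq> 0"
proof -
  \<comment> \<open>Kronecker substitution: \<open>x\<^sub>i = z ^ M ^ i\<close> keeps the monomials of \<open>G\<close> apart.\<close>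
  obtain t0 where t0: "t0 \<in> Poly_Mapping.keys G" using G by (metis equals0I keys_eq_empty)
  obtain e :: "'i \<Rightarrow> nat" where e: "bij_betw e UNIV {..<CARD('i)}"
    using ex_bij_betw_finite_nat[of "UNIV :: 'i set"] by (auto simp: atLeast0LessThan)
  define S where "S = (\<lambda>(t, i). Poly_Mapping.lookup t i) ` (Poly_Mapping.keys G \<times> (UNIV :: 'i set))"
  \<comment> \<open>\<open>M\<close> exceeds every exponent occurring in \<open>G\<close>, so the
    exponents of a monomial are digits in base \<open>M\<close>.\<close>
  define M where "M = Suc (Max S)"
  have M: "Poly_Mapping.lookup t i < M" if "t \<in> Poly_Mapping.keys G" for t i
  proof -
    have "finite S" by (simp add: S_def)
    moreover have "Poly_Mapping.lookup t i \<in> S" using that by (auto simp: S_def)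
    ultimately show ?thesis by (simp add: M_def less_Suc_eq_le)
  qed
  define \<kappa> where "\<kappa> t = (\<Sum>i\<in>UNIV. Poly_Mapping.lookup t i * M ^ e i)" for t :: "'i \<Rightarrow>\<^sub>0 nat"
  let ?e' = "inv_into UNIV e"
  have \<kappa>: "\<kappa> t = (\<Sum>j<CARD('i). Poly_Mapping.lookup t (?e' j) * M ^ j)" for t
    unfolding \<kappa>_def
    by (rule sum.reindex_bij_witness[of _ ?e' e]) 
       (use e in \<open>auto simp: bij_betw_def f_inv_into_f\<close>)
  have inj: "inj_on \<kappa> (Poly_Mapping.keys G)"
  proof (rule inj_onI)
    fix s t assume st: "s \<in> Poly_Mapping.keys G" "t \<in> Poly_Mapping.keys G" "\<kappa> s = \<kappa> t"
    have "Poly_Mapping.lookup s (?e' j) = Poly_Mapping.lookup t (?e' j)" if "j < CARD('i)" for j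
      by (rule base_expansion_unique[of "CARD('i)" "\<lambda>j. Poly_Mapping.lookup s (?e' j)" M
            "\<lambda>j. Poly_Mapping.lookup t (?e' j)"])
         (use M st that \<kappa> in auto)
    then have "Poly_Mapping.lookup s i = Poly_Mapping.lookup t i" for i
      using e by (metis UNIV_I bij_betw_apply bij_betw_inv_into_left lessThan_iff)
    then show "s = t" by (rule poly_mapping_eqI)
  qed
  define Q where "Q = (\<Sum>t\<in>Poly_Mapping.keys G. Polynomial.monom (Poly_Mapping.lookup G t) (\<kappa> t))"
  \<comment> \<open>Since \<open>\<kappa>\<close> is injective on the monomials of \<open>G\<close>,
    only \<open>t0\<close> contributes to this coefficient.\<close>
  have "Polynomial.coeff Q (\<kappa> t0) = (\<Sum>t\<in>Poly_Mapping.keys G. if t = t0 then Poly_Mapping.lookup G t else 0)"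
    unfolding Q_def coeff_sum
    by (intro sum.cong refl) (use inj t0 in \<open>auto simp: inj_on_def\<close>)
  also have "\<dots> \<noteq> 0" using t0 by (simp add: in_keys_iff)
  finally have "Q \<noteq> 0" by auto
  then have "finite {z. poly Q z = 0}" by (rule poly_roots_finite)
  then obtain z where z: "poly Q z \<noteq> 0"
    using inf by (metis (mono_tags) finite_subset mem_Collect_eq subsetI)
  have "meval (\<lambda>i. z ^ M ^ e i) G = poly Q z"
    by (simp add: meval_def Q_def poly_sum poly_monom \<kappa>_def power_sum mult.commute
        flip: power_mult)
  then show thesis using z that by metis
qed

section \<open>Thin sets\<close>

text \<open>The witness must have a nonzero value, not just be formally nonzero: arguments along
  lines start from such a value.\<close>

definition thin :: "('i::finite \<Rightarrow> 'k::field) set \<Rightarrow> bool" where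
  "thin S \<longleftrightarrow> (\<exists>G. (\<exists>x. meval x G \<noteq> 0) \<and> (\<forall>x\<in>S. meval x G = 0))"

lemma thin_subset: "thin T \<Longrightarrow> S \<subseteq> T \<Longrightarrow> thin S"
  unfolding thin_def by blast

lemma thin_empty [simp]: "thin {}"
  unfolding thin_def by (intro exI[of _ 1]) auto

lemma meval_polyfuns: "(\<lambda>x. meval x G) \<in> polyfuns coords"
  by (intro polyfuns_meval polyfuns_base) auto

lemma thin_Un:
  fixes S T :: "('i::finite \<Rightarrow> 'k::field) set"
  assumes inf: "infinite (UNIV :: 'k set)" and "thin S" "thin T"
  shows "thin (S \<union> T)"
proof -
  obtain G x H y where G: "meval x G \<noteq> 0" "\<forall>x\<in>S. meval x G = 0"
    and H: "meval y H \<noteq> 0" "\<forall>x\<in>T. meval x H = 0"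
    using assms unfolding thin_def by blast
  obtain z where "meval z G \<noteq> 0" "meval z H \<noteq> 0"
    by (rule polyfuns_common_nonzero[where f = "\<lambda>x. meval x G" and g = "\<lambda>x. meval x H",
          OF inf meval_polyfuns G(1) meval_polyfuns H(1)])
  then show ?thesis
    unfolding thin_def using G H by (intro exI[of _ "G * H"]) (auto simp: meval_mult)
qed

lemma thin_UN:
  fixes S :: "'a \<Rightarrow> ('i::finite \<Rightarrow> 'k::field) set"
  assumes inf: "infinite (UNIV :: 'k set)" and "finite A" "\<And>a. a \<in> A \<Longrightarrow> thin (S a)"
  shows "thin (\<Union>a\<in>A. S a)"
  using assms(2,3) by (induction A rule: finite_induct) (auto intro: thin_Un[OF inf])

section \<open>Spans of monomials in finitely many functions\<close>

lemma sum_fun_pointwise: "(\<Sum>i\<in>A. f i) p = (\<Sum>i\<in>A. f i p)" for f :: "'a \<Rightarrow> 'p \<Rightarrow> 'k::comm_monoid_add"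
  by (induction A rule: infinite_finite_induct) auto

text \<open>An indexed family is needed, as different monomials may agree after substitution; a
  coincidence \<open>m a = m b\<close> is then itself a relation.\<close>

lemma (in vector_space) dependent_family:
  assumes "finite T" "finite S" "card S < card T" "\<And>t. t \<in> T \<Longrightarrow> m t \<in> span S"
  obtains u t where "t \<in> T" "u t \<noteq> 0" "(\<Sum>t\<in>T. scale (u t) (m t)) = 0"
proof (cases "inj_on m T")
  case True
  have "dependent (m ` T)"
  proof (rule ccontr)
    assume "independent (m ` T)"
    then have "card (m ` T) \<le> card S"
      using independent_span_bound[OF assms(2)] assms(4) by blast
    then show False using assms(3) card_image[OF True] by simp
  qed
  then obtain u v where u: "v \<in> m ` T" "u v \<noteq> 0" "(\<Sum>v\<in>m ` T. scale (u v) v) = 0"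
    using dependent_finite[of "m ` T"] assms(1) by auto
  then show thesis
    using that[of _ "\<lambda>t. u (m t)"] by (auto simp: sum.reindex[OF True])
next
  case False
  then obtain a b where ab: "a \<in> T" "b \<in> T" "a \<noteq> b" "m a = m b" by (auto simp: inj_on_def)
  let ?u = "\<lambda>t. if t = a then 1 else if t = b then - 1 else 0"
  have "(\<Sum>t\<in>T. scale (?u t) (m t)) = (\<Sum>t\<in>{a, b}. scale (?u t) (m t))"
    using ab assms(1) by (intro sum.mono_neutral_right) auto
  also have "\<dots> = 0" using ab by simp
  finally show thesis using that[of a ?u] ab by simp
qed

interpretation fun_vs: vector_space "\<lambda>(c::'k::field) (f::'p \<Rightarrow> 'k) p. c * f p"
  by unfold_locales (auto simp: fun_eq_iff algebra_simps)

text \<open>The degree is bounded in each generator separately, so that counting exponent functions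
  is counting \<open>J \<rightarrow>\<^sub>E {..D}\<close>.\<close>

definition monofuns :: "('p \<Rightarrow> 'k::field) set \<Rightarrow> nat \<Rightarrow> ('p \<Rightarrow> 'k) set" where
  "monofuns J D = (\<lambda>e p. \<Prod>j\<in>J. j p ^ e j) ` (J \<rightarrow>\<^sub>E {..D})"

lemma monofunsI:
  assumes "\<And>j. j \<in> J \<Longrightarrow> e j \<le> D"
  shows "(\<lambda>p. \<Prod>j\<in>J. j p ^ e j) \<in> monofuns J D"
  unfolding monofuns_def
  by (rule image_eqI[of _ _ "restrict e J"]) (use assms in auto)

lemma monofunsE:
  assumes "f \<in> monofuns J D"
  obtains e where "f = (\<lambda>p. \<Prod>j\<in>J. j p ^ e j)" "\<forall>j\<in>J. e j \<le> D"
  using assms unfolding monofuns_def by auto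

lemma
  assumes "finite J"
  shows finite_monofuns: "finite (monofuns J D)"
    and card_monofuns_le: "card (monofuns J D) \<le> Suc D ^ card J"
proof -
  have fin: "finite (J \<rightarrow>\<^sub>E {..D})" using assms by (intro finite_PiE) auto
  then show "finite (monofuns J D)" by (simp add: monofuns_def)
  show "card (monofuns J D) \<le> Suc D ^ card J"
    using card_image_le[OF fin, of "\<lambda>e p. \<Prod>j\<in>J. j p ^ e j"] card_PiE[OF assms, of "\<lambda>_. {..D}"]
    by (simp add: monofuns_def)
qed

lemma monofuns_mono: "D \<le> E \<Longrightarrow> monofuns J D \<subseteq> monofuns J E"
  by (auto elim!: monofunsE intro!: monofunsI intro: order_trans)

text \<open>By bilinearity, a nested span induction reduces this to two monomials, whose exponents
  add.\<close>

lemma span_monofuns_mult: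
  assumes f: "f \<in> fun_vs.span (monofuns J D)" and g: "g \<in> fun_vs.span (monofuns J E)"
  shows "(\<lambda>p. f p * g p) \<in> fun_vs.span (monofuns J (D + E))"
  using f
proof (induction rule: fun_vs.span_induct_alt)
  case base
  then show ?case using fun_vs.span_zero by (simp add: zero_fun_def)
next
  case (step c m f)
  have "(\<lambda>p. m p * g p) \<in> fun_vs.span (monofuns J (D + E))"
    using g
  proof (induction rule: fun_vs.span_induct_alt)
    case base
    then show ?case using fun_vs.span_zero by (simp add: zero_fun_def)
  next
    case (step d n g)
    obtain a where a: "m = (\<lambda>p. \<Prod>j\<in>J. j p ^ a j)" "\<forall>j\<in>J. a j \<le> D"
      using \<open>m \<in> _\<close> by (rule monofunsE)
    obtain b where b: "n = (\<lambda>p. \<Prod>j\<in>J. j p ^ b j)" "\<forall>j\<in>J. b j \<le> E"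
      using \<open>n \<in> _\<close> by (rule monofunsE)
    have "(\<lambda>p. m p * n p) = (\<lambda>p. \<Prod>j\<in>J. j p ^ (a j + b j))"
      by (simp add: a b power_add prod.distrib)
    also have "\<dots> \<in> monofuns J (D + E)"
      by (rule monofunsI) (use a b in \<open>auto intro: add_mono\<close>)
    finally have "(\<lambda>p. m p * n p) \<in> fun_vs.span (monofuns J (D + E))"
      by (rule fun_vs.span_base)
    from fun_vs.span_add[OF fun_vs.span_scale[OF this, of d] step(2)]
    show ?case by (simp add: plus_fun_def algebra_simps)
  qed
  from fun_vs.span_add[OF fun_vs.span_scale[OF this, of c] step(2)]
  show ?case by (simp add: plus_fun_def algebra_simps)
qed

lemma span_monofuns_one: "(\<lambda>p. 1) \<in> fun_vs.span (monofuns J D)"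
  using fun_vs.span_base[OF monofunsI[of J "\<lambda>_. 0" D]] by simp

lemma span_monofuns_power:
  assumes "f \<in> fun_vs.span (monofuns J D)"
  shows "(\<lambda>p. f p ^ n) \<in> fun_vs.span (monofuns J (n * D))"
proof (induction n)
  case 0
  show ?case by (simp add: span_monofuns_one)
next
  case (Suc n)
  then show ?case using span_monofuns_mult[OF assms Suc] by simp
qed

lemma span_monofuns_prod:
  assumes "finite A" "\<And>i. i \<in> A \<Longrightarrow> f i \<in> fun_vs.span (monofuns J D)"
  shows "(\<lambda>p. \<Prod>i\<in>A. f i p) \<in> fun_vs.span (monofuns J (card A * D))"
  using assms
proof (induction A rule: finite_induct)
  case empty
  show ?case by (simp add: span_monofuns_one)
next
  case (insert i A)
  then show ?case
    using span_monofuns_mult[of "f i" J D "\<lambda>p. \<Prod>i\<in>A. f i p"] by simp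
qed

lemma polyfuns_span_monofuns:
  assumes "finite J" "f \<in> polyfuns J"
  shows "\<exists>D. f \<in> fun_vs.span (monofuns J D)"
  using assms(2)
proof induction
  case (polyfuns_const c)
  show ?case using fun_vs.span_scale[OF span_monofuns_one, of c] by auto
next
  case (polyfuns_base f)
  have "(\<Prod>j\<in>J. j p ^ (if j = f then 1 else 0)) = f p" for p
  proof -
    have "(\<Prod>j\<in>J. j p ^ (if j = f then 1 else 0)) = (\<Prod>j\<in>J. if j = f then f p else 1)"
      by (intro prod.cong) auto
    then show ?thesis using polyfuns_base assms(1) by simp
  qed
  then have "f \<in> monofuns J 1"
    using monofunsI[of J "\<lambda>j. if j = f then 1 else 0" 1] by simp
  then show ?case using fun_vs.span_base by blast
next
  case (polyfuns_add f g)
  then obtain D E where "f \<in> fun_vs.span (monofuns J D)" "g \<in> fun_vs.span (monofuns J E)" by blast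
  then have "f \<in> fun_vs.span (monofuns J (max D E))" "g \<in> fun_vs.span (monofuns J (max D E))"
    using fun_vs.span_mono[OF monofuns_mono, of D "max D E" J]
      fun_vs.span_mono[OF monofuns_mono, of E "max D E" J] by auto
  from fun_vs.span_add[OF this] show ?case by (auto simp: plus_fun_def)
next
  case (polyfuns_mult f g)
  then show ?case using span_monofuns_mult by blast
qed

text \<open>
  With \<open>r < N\<close> parameters, the \<open>(s + 1) ^ N\<close> monomials of degree at most \<open>s\<close> in each of the \<open>N\<close>
  coordinates of \<open>\<phi>\<close> lie in a space of dimension \<open>O(s ^ r)\<close>, so they are dependent for large \<open>s\<close>.
\<close>

lemma thin_range:
  fixes \<phi> :: "'p \<Rightarrow> 'i::finite \<Rightarrow> 'k::field"
  assumes inf: "infinite (UNIV :: 'k set)" and J: "finite J" "card J < CARD('i)"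
    and \<phi>: "\<And>i. (\<lambda>p. \<phi> p i) \<in> polyfuns J"
  shows "thin (range \<phi>)"
proof -
  let ?N = "CARD('i)"
  have "\<forall>i. \<exists>D. (\<lambda>p. \<phi> p i) \<in> fun_vs.span (monofuns J D)"
    using polyfuns_span_monofuns[OF J(1) \<phi>] by blast
  then obtain D where D: "\<And>i. (\<lambda>p. \<phi> p i) \<in> fun_vs.span (monofuns J (D i))" by metis
  define E where "E = Max (range D)"
  have "D i \<le> E" for i by (simp add: E_def)
  then have E: "(\<lambda>p. \<phi> p i) \<in> fun_vs.span (monofuns J E)" for i
    using D fun_vs.span_mono[OF monofuns_mono] by blast
  \<comment> \<open>Here \<open>?N * (s * E) + 1 \<le> C * (s + 1)\<close>, and the choice
    \<open>s = C ^ card J\<close> absorbs the constant: \<open>(C * (s + 1)) ^ card J = s * (s + 1)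
    ^ card J < (s + 1) ^ (card J + 1)\<close>, which is at most \<open>card T\<close> because
    \<open>card J < ?N\<close>.\<close>
  define C where "C = Suc (?N * E)"
  define s where "s = C ^ card J"
  define T where "T = (UNIV :: 'i set) \<rightarrow>\<^sub>E {..s}"
  have T: "finite T" "card T = Suc s ^ ?N"
    unfolding T_def by (auto intro: finite_PiE simp: card_PiE)
  have m: "(\<lambda>p. \<Prod>i\<in>UNIV. \<phi> p i ^ t i) \<in> fun_vs.span (monofuns J (?N * (s * E)))" if "t \<in> T" for t
  proof (rule span_monofuns_prod)
    fix i
    have "t i \<le> s" using that by (auto simp: T_def PiE_def Pi_def)
    then have "t i * E \<le> s * E" by simp
    then show "(\<lambda>p. \<phi> p i ^ t i) \<in> fun_vs.span (monofuns J (s * E))"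
      using span_monofuns_power[OF E, of i "t i"] fun_vs.span_mono[OF monofuns_mono] by blast
  qed simp
  have "card (monofuns J (?N * (s * E))) \<le> Suc (?N * (s * E)) ^ card J"
    by (rule card_monofuns_le[OF J(1)])
  also have "\<dots> \<le> (C * Suc s) ^ card J"
    by (intro power_mono) (auto simp: C_def algebra_simps)
  also have "\<dots> = s * Suc s ^ card J" by (simp only: power_mult_distrib s_def)
  also have "\<dots> < Suc s ^ Suc (card J)" by simp
  also have "\<dots> \<le> card T" unfolding T(2) using J(2) by (intro power_increasing) auto
  finally have lt: "card (monofuns J (?N * (s * E))) < card T" .
  obtain u t where u: "t \<in> T" "u t \<noteq> 0"
      "(\<Sum>t\<in>T. (\<lambda>p. u t * (\<Prod>i\<in>UNIV. \<phi> p i ^ t i))) = 0"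
    by (rule fun_vs.dependent_family[OF T(1) finite_monofuns[OF J(1)] lt,
          where m = "\<lambda>t p. \<Prod>i\<in>UNIV. \<phi> p i ^ t i"]) (rule m)
  \<comment> \<open>Over a finite index type every exponent function has finite support.\<close>
  have A: "Poly_Mapping.lookup (Abs_poly_mapping t) = t" for t :: "'i \<Rightarrow> nat"
    by (simp add: Abs_poly_mapping_inverse)
  define G where "G = (\<Sum>t\<in>T. Poly_Mapping.single (Abs_poly_mapping t) (u t))"
  have G: "meval x G = (\<Sum>t\<in>T. u t * (\<Prod>i\<in>UNIV. x i ^ t i))" for x
  proof -
    have "meval x (\<Sum>t\<in>S. Poly_Mapping.single (Abs_poly_mapping t) (u t)) =
        (\<Sum>t\<in>S. u t * (\<Prod>i\<in>UNIV. x i ^ t i))" if "finite S" for S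
      using that by (induction S rule: finite_induct) (auto simp: meval_add meval_single A)
    then show ?thesis unfolding G_def using T(1) by blast
  qed
  \<comment> \<open>Distinct exponent functions give distinct monomials, so a nontrivial relation
    yields a nonzero polynomial.\<close>
  have "Poly_Mapping.lookup G (Abs_poly_mapping t) = (\<Sum>t'\<in>T. if t' = t then u t' else 0)"
    unfolding G_def lookup_sum
    by (intro sum.cong refl) (auto simp: lookup_single when_def dest: arg_cong[of _ _ Poly_Mapping.lookup] simp: A)
  also have "\<dots> = u t" using u(1) T(1) by simp
  finally have "G \<noteq> 0" using u(2) by auto
  then obtain x where "meval x G \<noteq> 0" using mpoly_nonzero_point[OF inf] by blast
  moreover have "meval (\<phi> p) G = 0" for p
    using fun_cong[OF u(3), of p] by (simp add: G sum_fun_pointwise)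
  ultimately show ?thesis unfolding thin_def by auto
qed

section \<open>Matrices whose column space meets a small set\<close>

text \<open>The matrix-vector product, with the matrix stored as a point of the affine space whose
  coordinates are indexed by pairs (row, column).\<close>

definition comb :: "('m::finite \<times> 'n::finite \<Rightarrow> 'k::field) \<Rightarrow> ('n \<Rightarrow> 'k) \<Rightarrow> 'k ^ 'm" where
  "comb M a = (\<chi> r. \<Sum>l\<in>UNIV. a l * M (r, l))"

lemma comb_diff: "comb M (\<lambda>l. a l - b l) = comb M a - comb M b"
  by (simp add: comb_def vec_eq_iff algebra_simps sum_subtractf)

lemma comb_scale: "comb M (\<lambda>l. c * a l) = c *s comb M a"
  by (simp add: comb_def vec_eq_iff algebra_simps sum_distrib_left)

text \<open>One column is determined by the point \<open>\<psi> q\<close>, the \<open>n - 1\<close>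
  other coefficients and the other columns. That makes \<open>card J + (n - 1) + m * (n - 1)\<close>
  parameters, fewer than \<open>m * n\<close> exactly when
  \<open>card J + n \<le> m\<close>.\<close>

lemma thin_meets:
  fixes \<psi> :: "'q \<Rightarrow> 'k::field ^ 'm::finite"
  assumes inf: "infinite (UNIV :: 'k set)" and J: "finite J" "card J + CARD('n::finite) \<le> CARD('m)"
    and \<psi>: "\<And>r. (\<lambda>q. \<psi> q $ r) \<in> polyfuns J"
  shows "thin {M :: 'm \<times> 'n \<Rightarrow> 'k. \<exists>a. (\<exists>i. a i = 1) \<and> comb M a \<in> range \<psi>}"
proof -
  \<comment> \<open>Solve the relation \<open>comb M a = \<psi> q\<close> for column \<open>i\<close>.\<close>
  define \<phi> :: "'n \<Rightarrow> 'q \<times> ('n \<Rightarrow> 'k) \<times> ('m \<times> 'n \<Rightarrow> 'k) \<Rightarrow> 'm \<times> 'n \<Rightarrow> 'k" where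
    "\<phi> = (\<lambda>i (q, a, M) (r, c). if c = i then \<psi> q $ r - (\<Sum>l\<in>UNIV - {i}. a l * M (r, l)) else M (r, c))"
  have thin_i: "thin (range (\<phi> i))" for i
  proof -
    let ?A = "UNIV - {i}"
    \<comment> \<open>\<open>\<phi> i\<close> ignores \<open>a i\<close> and column \<open>i\<close>
      of \<open>M\<close>, so only the remaining coordinates are generators.\<close>
    define K1 where "K1 = (\<lambda>f (p :: 'q \<times> ('n \<Rightarrow> 'k) \<times> ('m \<times> 'n \<Rightarrow> 'k)). f (fst p)) ` J"
    define K2 where "K2 = (\<lambda>l (p :: 'q \<times> ('n \<Rightarrow> 'k) \<times> ('m \<times> 'n \<Rightarrow> 'k)). fst (snd p) l) ` ?A"
    define K3 where "K3 = (\<lambda>rl (p :: 'q \<times> ('n \<Rightarrow> 'k) \<times> ('m \<times> 'n \<Rightarrow> 'k)). snd (snd p) rl) ` (UNIV \<times> ?A)"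
    let ?K = "K1 \<union> K2 \<union> K3"
    have fin: "finite ?K" using J(1) by (simp add: K1_def K2_def K3_def)
    have "card ?K \<le> card K1 + card K2 + card K3"
      by (meson add_le_mono card_Un_le le_refl le_trans)
    also have "card K1 \<le> card J" unfolding K1_def by (rule card_image_le[OF J(1)])
    also have "card K2 \<le> CARD('n) - 1" unfolding K2_def using card_image_le[of ?A] by simp
    also have "card K3 \<le> CARD('m) * (CARD('n) - 1)"
      unfolding K3_def using card_image_le[of "(UNIV :: 'm set) \<times> ?A"]
      by (simp add: card_cartesian_product)
    finally have le: "card ?K \<le> card J + (CARD('n) - 1) + CARD('m) * (CARD('n) - 1)" by simp
    have "0 < CARD('n)" by simp
    then obtain n' where n': "CARD('n) = Suc n'" by (metis gr0_implies_Suc)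
    have lt: "card ?K < CARD('m \<times> 'n)" using le J(2) unfolding card_prod n' by simp
    have 1: "(\<lambda>p. \<psi> (fst p) $ r) \<in> polyfuns ?K" for r
      by (rule polyfuns_comp[OF \<psi>]) (auto intro!: polyfuns_base simp: K1_def)
    have 2: "(\<lambda>p. fst (snd p) l) \<in> polyfuns ?K" if "l \<noteq> i" for l
      by (rule polyfuns_base) (use that in \<open>auto simp: K2_def\<close>)
    have 3: "(\<lambda>p. snd (snd p) (r, l)) \<in> polyfuns ?K" if "l \<noteq> i" for r l
      by (rule polyfuns_base) (use that in \<open>auto simp: K3_def\<close>)
    have "(\<lambda>p. \<phi> i p (r, c)) \<in> polyfuns ?K" for r c
    proof (cases "c = i")
      case True
      then show ?thesis
        unfolding \<phi>_def by (simp add: case_prod_beta, intro polyfuns_intros 1 2 3) auto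
    next
      case False
      then show ?thesis unfolding \<phi>_def by (simp add: case_prod_beta 3)
    qed
    then have "(\<lambda>p. \<phi> i p rc) \<in> polyfuns ?K" for rc by (cases rc) simp
    then show ?thesis by (rule thin_range[OF inf fin lt])
  qed
  have "{M :: 'm \<times> 'n \<Rightarrow> 'k. \<exists>a. (\<exists>i. a i = 1) \<and> comb M a \<in> range \<psi>} \<subseteq> (\<Union>i\<in>UNIV. range (\<phi> i))"
  proof clarify
    fix M :: "'m \<times> 'n \<Rightarrow> 'k" and a :: "'n \<Rightarrow> 'k" and i q
    assume ai: "a i = 1" and q: "comb M a = \<psi> q"
    have "M (r, i) = \<psi> q $ r - (\<Sum>l\<in>UNIV - {i}. a l * M (r, l))" for r
      by (simp add: q[symmetric] comb_def sum.remove[of UNIV i] ai)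
    then have "M = \<phi> i (q, a, M)" unfolding \<phi>_def by (auto simp: fun_eq_iff)
    then show "M \<in> (\<Union>i\<in>UNIV. range (\<phi> i))" by blast
  qed
  moreover have "thin (\<Union>i\<in>UNIV. range (\<phi> i))"
    by (rule thin_UN[OF inf]) (auto intro: thin_i)
  ultimately show ?thesis by (rule thin_subset[rotated])
qed

text \<open>Two columns are determined. The parameters are \<open>card J\<close> for the pair,
  \<open>n - 1\<close> for \<open>a\<close>, \<open>n - 2\<close> for \<open>e\<close>, two for
  \<open>c\<close> and \<open>d\<close>, and \<open>m * (n - 2)\<close> for the other columns; their
  number is below \<open>m * n\<close> exactly when
  \<open>card J + 2 * n \<le> 2 * m\<close>.\<close>

lemma thin_meets_pair:
  fixes \<psi> \<psi>' :: "'q \<Rightarrow> 'k::field ^ 'm::finite"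
  assumes inf: "infinite (UNIV :: 'k set)"
    and J: "finite J" "card J + 2 * CARD('n::finite) \<le> 2 * CARD('m)"
    and \<psi>: "\<And>r. (\<lambda>q. \<psi> q $ r) \<in> polyfuns J" and \<psi>': "\<And>r. (\<lambda>q. \<psi>' q $ r) \<in> polyfuns J"
  shows "thin {M :: 'm \<times> 'n \<Rightarrow> 'k. \<exists>a e i j c d q. i \<noteq> j \<and> a i = 1 \<and> e i = 0 \<and> e j = 1 \<and>
           comb M a = \<psi> q \<and> comb M e = c *s (\<psi>' q - d *s \<psi> q)}" (is "thin ?S")
proof -
  \<comment> \<open>Solve the second relation for column \<open>j\<close>, then the first for column \<open>i\<close>.\<close>
  define \<xi> :: "'n \<Rightarrow> 'n \<Rightarrow> 'q \<times> ('n \<Rightarrow> 'k) \<times> ('n \<Rightarrow> 'k) \<times> 'k \<times> 'k \<times> ('m \<times> 'n \<Rightarrow> 'k) \<Rightarrow> 'm \<Rightarrow> 'k" where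
    "\<xi> = (\<lambda>i j (q, a, e, c, d, M) r.
       c * (\<psi>' q $ r - d * \<psi> q $ r) - (\<Sum>l\<in>UNIV - {i, j}. e l * M (r, l)))"
  define \<phi> :: "'n \<Rightarrow> 'n \<Rightarrow> 'q \<times> ('n \<Rightarrow> 'k) \<times> ('n \<Rightarrow> 'k) \<times> 'k \<times> 'k \<times> ('m \<times> 'n \<Rightarrow> 'k)
      \<Rightarrow> 'm \<times> 'n \<Rightarrow> 'k" where
    "\<phi> = (\<lambda>i j (q, a, e, c, d, M) (r, l).
       if l = i then \<psi> q $ r - a j * \<xi> i j (q, a, e, c, d, M) r - (\<Sum>l\<in>UNIV - {i, j}. a l * M (r, l))
       else if l = j then \<xi> i j (q, a, e, c, d, M) r else M (r, l))"
  have thin_ij: "thin (range (\<phi> i j))" if ij: "i \<noteq> j" for i j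
  proof -
    let ?A = "UNIV - {i, j}"
    define K1 :: "('q \<times> ('n \<Rightarrow> 'k) \<times> ('n \<Rightarrow> 'k) \<times> 'k \<times> 'k \<times> ('m \<times> 'n \<Rightarrow> 'k) \<Rightarrow> 'k) set"
      where "K1 = (\<lambda>f p. f (fst p)) ` J"
    define K2 :: "('q \<times> ('n \<Rightarrow> 'k) \<times> ('n \<Rightarrow> 'k) \<times> 'k \<times> 'k \<times> ('m \<times> 'n \<Rightarrow> 'k) \<Rightarrow> 'k) set"
      where "K2 = (\<lambda>l (q, a, e, c, d, M). a l) ` (UNIV - {i})"
    define K3 :: "('q \<times> ('n \<Rightarrow> 'k) \<times> ('n \<Rightarrow> 'k) \<times> 'k \<times> 'k \<times> ('m \<times> 'n \<Rightarrow> 'k) \<Rightarrow> 'k) set"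
      where "K3 = (\<lambda>l (q, a, e, c, d, M). e l) ` ?A"
    define K4 :: "('q \<times> ('n \<Rightarrow> 'k) \<times> ('n \<Rightarrow> 'k) \<times> 'k \<times> 'k \<times> ('m \<times> 'n \<Rightarrow> 'k) \<Rightarrow> 'k) set"
      where "K4 = {\<lambda>(q, a, e, c, d, M). c, \<lambda>(q, a, e, c, d, M). d}"
    define K5 :: "('q \<times> ('n \<Rightarrow> 'k) \<times> ('n \<Rightarrow> 'k) \<times> 'k \<times> 'k \<times> ('m \<times> 'n \<Rightarrow> 'k) \<Rightarrow> 'k) set"
      where "K5 = (\<lambda>rl (q, a, e, c, d, M). M rl) ` (UNIV \<times> ?A)"
    let ?K = "K1 \<union> K2 \<union> K3 \<union> K4 \<union> K5"
    have fin: "finite ?K" using J(1) by (simp add: K1_def K2_def K3_def K4_def K5_def)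
    have "card {i, j} \<le> CARD('n)" by (rule card_mono) auto
    then have "2 \<le> CARD('n)" using ij by simp
    then obtain n' where n': "CARD('n) = Suc (Suc n')"
      by (metis add_2_eq_Suc le_Suc_ex)
    have cA: "card ?A = n'" using n' ij by (simp add: card_Diff_subset)
    have "card ?K \<le> card K1 + card K2 + card K3 + card K4 + card K5"
      by (meson add_le_mono card_Un_le le_refl le_trans)
    moreover have "card K1 \<le> card J" unfolding K1_def by (rule card_image_le[OF J(1)])
    moreover have "card K2 \<le> Suc n'" unfolding K2_def using card_image_le[of "UNIV - {i}"] n' by simp
    moreover have "card K3 \<le> n'" unfolding K3_def using card_image_le[of ?A] cA by simp
    moreover have "card K4 \<le> 2" unfolding K4_def by (simp add: card_insert_if)
    moreover have "card K5 \<le> CARD('m) * n'"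
      unfolding K5_def using card_image_le[of "(UNIV :: 'm set) \<times> ?A"] cA
      by (simp add: card_cartesian_product)
    ultimately have le: "card ?K \<le> card J + Suc n' + n' + 2 + CARD('m) * n'" by linarith
    have lt: "card ?K < CARD('m \<times> 'n)" using le J(2) unfolding card_prod n' by simp
    have 1: "(\<lambda>p. f (fst p)) \<in> polyfuns ?K" if "f \<in> polyfuns J" for f
      by (rule polyfuns_comp[OF that]) (auto intro!: polyfuns_base simp: K1_def)
    have 2: "(\<lambda>(q, a, e, c, d, M). a l) \<in> polyfuns ?K" if "l \<noteq> i" for l
      by (rule polyfuns_base) (use that in \<open>auto simp: K2_def\<close>)
    have 3: "(\<lambda>(q, a, e, c, d, M). e l) \<in> polyfuns ?K" if "l \<noteq> i" "l \<noteq> j" for l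
      by (rule polyfuns_base) (use that in \<open>auto simp: K3_def\<close>)
    have 4: "(\<lambda>(q, a, e, c, d, M). c) \<in> polyfuns ?K" "(\<lambda>(q, a, e, c, d, M). d) \<in> polyfuns ?K"
      by (auto intro!: polyfuns_base simp: K4_def)
    have 5: "(\<lambda>(q, a, e, c, d, M). M (r, l)) \<in> polyfuns ?K" if "l \<noteq> i" "l \<noteq> j" for r l
      by (rule polyfuns_base) (use that in \<open>auto simp: K5_def\<close>)
    note pf = 1[OF \<psi>] 1[OF \<psi>'] 2 3 4 5
    have \<xi>: "(\<lambda>p. \<xi> i j p r) \<in> polyfuns ?K" for r
      using pf unfolding \<xi>_def case_prod_beta by (intro polyfuns_intros) auto
    have "(\<lambda>p. \<phi> i j p (r, l)) \<in> polyfuns ?K" for r l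
    proof -
      consider "l = i" | "l = j" "l \<noteq> i" | "l \<noteq> i" "l \<noteq> j" by blast
      then show ?thesis
      proof cases
        case 1
        then show ?thesis
          using pf \<xi> ij unfolding \<phi>_def case_prod_beta by (simp, intro polyfuns_intros) auto
      next
        case 2
        then show ?thesis using \<xi> unfolding \<phi>_def case_prod_beta by simp
      next
        case 3
        then show ?thesis using 5 unfolding \<phi>_def case_prod_beta by simp
      qed
    qed
    then have "(\<lambda>p. \<phi> i j p rc) \<in> polyfuns ?K" for rc by (cases rc) simp
    then show ?thesis by (rule thin_range[OF inf fin lt])
  qed
  have "?S \<subseteq> (\<Union>(i, j)\<in>{(i, j). i \<noteq> j}. range (\<phi> i j))"
  proof clarify
    fix M :: "'m \<times> 'n \<Rightarrow> 'k" and a e :: "'n \<Rightarrow> 'k" and i j c d q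
    assume ij: "i \<noteq> j" and a: "a i = 1" and e: "e i = 0" "e j = 1"
      and va: "comb M a = \<psi> q" and ve: "comb M e = c *s (\<psi>' q - d *s \<psi> q)"
    have split: "sum g UNIV = g i + g j + sum g (UNIV - {i, j})" for g :: "'n \<Rightarrow> 'k"
      using ij by (simp add: sum.remove[of UNIV i] sum.remove[of "UNIV - {i}" j] add.assoc
          Diff_insert2[symmetric] insert_commute)
    have Xj: "M (r, j) = \<xi> i j (q, a, e, c, d, M) r" for r
    proof -
      have "c * (\<psi>' q $ r - d * \<psi> q $ r) = comb M e $ r" by (simp add: ve algebra_simps)
      also have "\<dots> = M (r, j) + (\<Sum>l\<in>UNIV - {i, j}. e l * M (r, l))"
        by (simp add: comb_def split[of "\<lambda>l. e l * M (r, l)"] e)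
      finally show ?thesis by (simp add: \<xi>_def)
    qed
    have "\<psi> q $ r = M (r, i) + a j * M (r, j) + (\<Sum>l\<in>UNIV - {i, j}. a l * M (r, l))" for r
      by (simp add: va[symmetric] comb_def split[of "\<lambda>l. a l * M (r, l)"] a)
    then have "M = \<phi> i j (q, a, e, c, d, M)"
      unfolding \<phi>_def by (auto simp: fun_eq_iff Xj[symmetric])
    then show "M \<in> (\<Union>(i, j)\<in>{(i, j). i \<noteq> j}. range (\<phi> i j))" using ij by blast
  qed
  moreover have "thin (\<Union>(i, j)\<in>{(i, j). i \<noteq> j}. range (\<phi> i j))"
    by (rule thin_UN[OF inf]) (auto intro: thin_ij)
  ultimately show ?thesis by (rule thin_subset[rotated])
qed

section \<open>Linear algebra\<close>

text \<open>The coordinates of \<open>v\<close> with respect to \<open>D\<close> are supported both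
  in \<open>B\<close> and in \<open>D - B\<close>.\<close>

lemma independent_span_disjoint:
  fixes v :: "'k::field ^ 'a::finite"
  assumes D: "vec.independent D" "B \<subseteq> D" and v: "v \<in> vec.span B" "v \<in> vec.span (D - B)"
  shows "v = 0"
proof -
  have eq: "vec.representation D v = vec.representation B v"
    "vec.representation D v = vec.representation (D - B) v"
    using D v by (auto intro!: vec.representation_extend)
  have "vec.representation D v b = 0" for b
    using vec.representation_ne_zero eq by (metis DiffD2)
  moreover have "v \<in> vec.span D" using v D vec.span_mono by blast
  ultimately show ?thesis using vec.sum_nonzero_representation_eq[OF D(1)] by fastforce
qed

text \<open>Extend a basis \<open>B\<close> of the kernel to a basis \<open>D\<close> of the whole
  space: \<open>f\<close> is injective on the span of \<open>D - B\<close>, which already has the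
  full image.\<close>

lemma rank_nullity:
  fixes f :: "'k::field ^ 'a::finite \<Rightarrow> 'k ^ 'b::finite"
  assumes f: "Vector_Spaces.linear (*s) (*s) f"
  shows "vec.dim {x. f x = 0} + vec.dim (range f) = CARD('a)"
proof -
  interpret f: Vector_Spaces.linear "(*s)" "(*s)" f by fact
  let ?N = "{x. f x = 0}"
  obtain B where B: "B \<subseteq> ?N" "vec.independent B" "?N \<subseteq> vec.span B" "card B = vec.dim ?N"
    using vec.basis_exists by blast
  obtain D where D: "B \<subseteq> D" "vec.independent D" "UNIV \<subseteq> vec.span D"
    using vec.maximal_independent_subset_extend[OF subset_UNIV B(2)] by metis
  have finD: "finite D" using D(2) vec.finiteI_independent by blast
  have cD: "card D = CARD('a)"
    using vec.dim_eq_card[of D UNIV] D(2,3) vec.dim_UNIV vec.dimension_def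
    by (metis card_cart_basis top.extremum_uniqueI vec.span_UNIV)
  have spB: "vec.span B = ?N"
    using B f.subspace_kernel vec.span_minimal by (metis subset_antisym)
  have inj: "inj_on f (vec.span (D - B))"
  proof (rule inj_onI)
    fix x y assume xy: "x \<in> vec.span (D - B)" "y \<in> vec.span (D - B)" "f x = f y"
    have "x - y \<in> vec.span B" unfolding spB using xy by (simp add: f.diff)
    moreover have "x - y \<in> vec.span (D - B)" using xy by (simp add: vec.span_diff)
    ultimately have "x - y = 0" by (rule independent_span_disjoint[OF D(2,1)])
    then show "x = y" by simp
  qed
  have "f ` vec.span (D - B) = range f"
  proof -
    have "f x \<in> f ` vec.span (D - B)" for x
    proof -
      have "x \<in> vec.span (B \<union> (D - B))" using D by (simp add: Un_absorb1 subset_iff)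
      then obtain y z where yz: "x = y + z" "y \<in> vec.span B" "z \<in> vec.span (D - B)"
        unfolding vec.span_Un by blast
      then have "f x = f z" using spB by (simp add: f.add)
      then show ?thesis using yz by auto
    qed
    then show ?thesis by auto
  qed
  then have "vec.dim (range f) = card (D - B)"
    using vec.dim_image_eq[OF f, of "vec.span (D - B)"] inj D(2)
    by (metis Diff_subset vec.dim_span_eq_card_independent vec.independent_mono vec.span_span)
  moreover have "card (D - B) = card D - card B"
    using D(1) finD finite_subset by (intro card_Diff_subset) auto
  moreover have "card B \<le> card D" using D(1) finD card_mono by blast
  ultimately show ?thesis using B(4) cD by simp
qed

text \<open>Parameters are functions on the whole space, but only their values on the basis
  \<open>B\<close> matter; this gives \<open>vec.dim S\<close> generators.\<close>

lemma subspace_parametrization: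
  fixes S :: "('k::field ^ 'a::finite) set"
  assumes S: "vec.subspace S"
  obtains \<psi> :: "('k ^ 'a \<Rightarrow> 'k) \<Rightarrow> 'k ^ 'a" and B where
    "\<psi> = (\<lambda>q. \<Sum>b\<in>B. q b *s b)" "finite B" "card B = vec.dim S" "S = range \<psi>"
proof -
  obtain B where B: "B \<subseteq> S" "vec.independent B" "S \<subseteq> vec.span B" "card B = vec.dim S"
    using vec.basis_exists by blast
  have fin: "finite B" using B(2) vec.finiteI_independent by blast
  have "S = vec.span B" using B vec.span_minimal[OF B(1) S] by auto
  then show thesis using that[OF refl fin B(4)] vec.span_finite[OF fin] by simp
qed

text \<open>An identity block inside \<open>f\<close>: choose independent vectors in the image, let
  \<open>\<iota>\<close> pick preimages and let \<open>\<pi>\<close> send the chosen vectors to the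
  unit vectors.\<close>

lemma exists_sub_identity:
  fixes f :: "'k::field ^ 'a::finite \<Rightarrow> 'k ^ 'b::finite"
  assumes f: "Vector_Spaces.linear (*s) (*s) f" and r: "CARD('c::finite) \<le> vec.dim (range f)"
  obtains \<iota> :: "'k ^ 'c \<Rightarrow> 'k ^ 'a" and \<pi> :: "'k ^ 'b \<Rightarrow> 'k ^ 'c" where
    "Vector_Spaces.linear (*s) (*s) \<iota>" "Vector_Spaces.linear (*s) (*s) \<pi>" "\<And>y. \<pi> (f (\<iota> y)) = y"
proof -
  interpret f: Vector_Spaces.linear "(*s)" "(*s)" f by fact
  obtain B where B: "B \<subseteq> range f" "vec.independent B" "card B = vec.dim (range f)"
    using vec.basis_exists by metis
  obtain C where C: "C \<subseteq> B" "card C = CARD('c)"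
    using r B(3) by (metis obtain_subset_with_card_n)
  have indC: "vec.independent C" using B(2) C(1) vec.independent_mono by blast
  obtain h :: "'c \<Rightarrow> 'k ^ 'b" where h: "bij_betw h UNIV C"
    using finite_same_card_bij[of "UNIV :: 'c set" C] C(2) indC vec.finiteI_independent by auto
  have "\<forall>s. \<exists>d. f d = h s" using h B(1) C(1) by (metis UNIV_I bij_betw_apply f_inv_into_f subset_iff)
  then obtain d where d: "\<And>s. f (d s) = h s" by metis
  obtain \<pi> :: "'k ^ 'b \<Rightarrow> 'k ^ 'c" where \<pi>: "Vector_Spaces.linear (*s) (*s) \<pi>"
      "\<And>x. x \<in> C \<Longrightarrow> \<pi> x = axis (inv_into UNIV h x) 1"
    using vec.linear_independent_extend[OF indC, of "\<lambda>x. axis (inv_into UNIV h x) 1"] by blast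
  interpret \<pi>: Vector_Spaces.linear "(*s)" "(*s)" \<pi> by fact
  let ?\<iota> = "\<lambda>y :: 'k ^ 'c. \<Sum>s\<in>UNIV. y $ s *s d s"
  have "\<pi> (h s) = axis s 1" for s
    using \<pi>(2)[of "h s"] h by (metis UNIV_I bij_betw_apply bij_betw_inv_into_left)
  then have "\<pi> (f (?\<iota> y)) = y" for y
    by (simp add: f.sum f.scale \<pi>.sum \<pi>.scale d basis_expansion)
  moreover have "Vector_Spaces.linear (*s) (*s) ?\<iota>"
    by unfold_locales (simp_all add: vec.scale_left_distrib sum.distrib vec.scale_sum_right)
  ultimately show thesis using that \<pi>(1) by blast
qed

section \<open>Matrices failing the conclusion\<close>

lemma thin_meets_subspace:
  fixes S :: "('k::field ^ 'm::finite) set"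
  assumes inf: "infinite (UNIV :: 'k set)" and S: "vec.subspace S"
    and le: "vec.dim S + CARD('n::finite) \<le> CARD('m)"
  shows "thin {M :: 'm \<times> 'n \<Rightarrow> 'k. \<exists>a. (\<exists>i. a i = 1) \<and> comb M a \<in> S}"
proof -
  obtain \<psi> :: "('k ^ 'm \<Rightarrow> 'k) \<Rightarrow> 'k ^ 'm" and B where
    \<psi>: "\<psi> = (\<lambda>q. \<Sum>b\<in>B. q b *s b)" "finite B" "card B = vec.dim S" "S = range \<psi>"
    by (rule subspace_parametrization[OF S])
  define J where "J = (\<lambda>b (q :: 'k ^ 'm \<Rightarrow> 'k). q b) ` B"
  have "finite J" "card J \<le> card B"
    unfolding J_def using \<psi>(2) by (auto intro: card_image_le)
  moreover have "(\<lambda>q. \<psi> q $ r) \<in> polyfuns J" for r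
    unfolding \<psi>(1) sum_component vector_smult_component
    by (intro polyfuns_intros polyfuns_base) (auto simp: J_def)
  ultimately show ?thesis
    unfolding \<psi>(4) using le \<psi>(3) by (intro thin_meets[OF inf]) auto
qed

lemma subspace_kernel:
  assumes "Vector_Spaces.linear (*s) (*s) f"
  shows "vec.subspace {x :: 'k::field ^ 'm::finite. f x = (0 :: 'k ^ 'l::finite)}"
proof -
  interpret Vector_Spaces.linear "(*s)" "(*s)" f by fact
  show ?thesis by (rule subspace_kernel)
qed

text \<open>The determinant is polynomial in \<open>\<mu>\<close>, so one nonzero value suffices.
  For \<open>\<mu> = inverse \<nu>\<close> it is, up to a power of \<open>- \<nu>\<close>, the
  determinant of \<open>1 - \<nu> N\<close>, which is 1 at \<open>\<nu> = 0\<close> and hence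
  nonzero at some \<open>\<nu> \<noteq> 0\<close>.\<close>

lemma finite_singular_shifts:
  fixes N :: "'k::field ^ 'c::finite ^ 'c"
  assumes inf: "infinite (UNIV :: 'k set)"
  shows "finite {\<mu>. det (\<chi> i j. N $ i $ j - (if i = j then \<mu> else 0)) = 0}"
proof -
  let ?f = "\<lambda>\<mu>. det (\<chi> i j. N $ i $ j - (if i = j then \<mu> else 0))"
  let ?g = "\<lambda>\<nu>. det (\<chi> i j. (if i = j then 1 else 0) - \<nu> * N $ i $ j)"
  have id: "(\<lambda>t. t) \<in> polyfuns {\<lambda>t :: 'k. t}" by (rule polyfuns_base) simp
  have f: "?f \<in> polyfuns {\<lambda>t. t}" by (intro polyfuns_det polyfuns_if polyfuns_intros id)
  have g: "?g \<in> polyfuns {\<lambda>t. t}" by (intro polyfuns_det polyfuns_intros id)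
  have "(\<chi> i j. if i = j then 1 else 0) = (mat 1 :: 'k ^ 'c ^ 'c)" by (simp add: mat_def)
  then have "?g 0 \<noteq> 0" by (simp add: det_I)
  with g id obtain \<nu> where \<nu>: "?g \<nu> \<noteq> 0" "\<nu> \<noteq> 0"
    using polyfuns_line_common_nonzero[OF inf g _ id, of 0 1] by auto
  have "?g \<nu> = det (\<chi> i. (- \<nu>) *s (\<chi> j. N $ i $ j - (if i = j then inverse \<nu> else 0)))"
    by (intro arg_cong[of _ _ det]) (use \<nu> in \<open>auto simp: vec_eq_iff algebra_simps\<close>)
  also have "\<dots> = (\<Prod>i\<in>(UNIV :: 'c set). - \<nu>) * ?f (inverse \<nu>)"
    by (subst det_rows_mul) simp
  finally have nz: "?f (inverse \<nu>) \<noteq> 0" using \<nu> by auto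
  obtain P where P: "\<And>t. ?f t = poly P t" using polyfuns_poly[OF f] by blast
  then have "P \<noteq> 0" using nz by auto
  then show ?thesis using poly_roots_finite[of P] by (simp add: P)
qed

text \<open>
  The kernel of \<open>\<tau>1 - \<mu>\<tau>2\<close> has to be parametrized polynomially in \<open>\<mu>\<close>. Given \<open>\<pi>\<tau>2\<iota> = 1\<close> on \<open>k\<^sup>2\<^sup>n\<close>, write
  \<open>w = \<iota> y + z\<close> with \<open>\<pi>\<tau>2 z = 0\<close>; Cramer's rule determines \<open>y\<close> from \<open>z\<close> and \<open>\<mu>\<close>, and the denominator
  disappears when \<open>z\<close> is replaced by its multiple by the determinant.
\<close>

lemma thin_meets_pencil_kernels:
  fixes \<tau>1 \<tau>2 :: "'k::field ^ 'm::finite \<Rightarrow> 'k ^ 'm"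
  assumes inf: "infinite (UNIV :: 'k set)"
    and l1: "Vector_Spaces.linear (*s) (*s) \<tau>1" and l2: "Vector_Spaces.linear (*s) (*s) \<tau>2"
    and r2: "2 * CARD('n::finite) \<le> vec.dim (range \<tau>2)"
  obtains L where "finite L"
    "thin {M :: 'm \<times> 'n \<Rightarrow> 'k. \<exists>a. (\<exists>i. a i = 1) \<and> (\<exists>\<mu>. \<mu> \<notin> L \<and> \<tau>1 (comb M a) = \<mu> *s \<tau>2 (comb M a))}"
proof -
  interpret l1: Vector_Spaces.linear "(*s)" "(*s)" \<tau>1 by fact
  interpret l2: Vector_Spaces.linear "(*s)" "(*s)" \<tau>2 by fact
  \<comment> \<open>The sum type \<open>'n + 'n\<close> is an index type with \<open>2 * n\<close>
    elements.\<close>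
  obtain \<iota> :: "'k ^ ('n + 'n) \<Rightarrow> 'k ^ 'm" and \<pi> :: "'k ^ 'm \<Rightarrow> 'k ^ ('n + 'n)" where
    \<iota>: "Vector_Spaces.linear (*s) (*s) \<iota>" and \<pi>: "Vector_Spaces.linear (*s) (*s) \<pi>"
    and id: "\<And>y. \<pi> (\<tau>2 (\<iota> y)) = y"
    using exists_sub_identity[OF l2, where 'c = "'n + 'n"] r2 by (auto simp: card_sum)
  interpret \<iota>: Vector_Spaces.linear "(*s)" "(*s)" \<iota> by fact
  interpret \<pi>: Vector_Spaces.linear "(*s)" "(*s)" \<pi> by fact
  have lin2: "Vector_Spaces.linear (*s) (*s) (\<lambda>x. \<pi> (\<tau>2 x))"
    using Vector_Spaces.linear_compose[OF l2 \<pi>] by (simp add: o_def)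
  have lin1: "Vector_Spaces.linear (*s) (*s) (\<lambda>y. \<pi> (\<tau>1 (\<iota> y)))"
    using Vector_Spaces.linear_compose[OF Vector_Spaces.linear_compose[OF \<iota> l1] \<pi>] by (simp add: o_def)
  define N where "N = matrix (\<lambda>y. \<pi> (\<tau>1 (\<iota> y)))"
  define A where "A \<mu> = (\<chi> i j. N $ i $ j - (if i = j then \<mu> else 0))" for \<mu>
  have N: "N *v y = \<pi> (\<tau>1 (\<iota> y))" for y unfolding N_def by (rule matrix_works[OF lin1])
  have A: "A \<mu> *v y = \<pi> (\<tau>1 (\<iota> y)) - \<mu> *s y" for \<mu> y
    unfolding N[symmetric] A_def
    by (simp add: vec_eq_iff matrix_vector_mult_def left_diff_distrib sum_subtractf
        if_distrib[of "\<lambda>x. x * _"] cong: if_cong)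
  define Z where "Z = {x. \<pi> (\<tau>2 x) = 0}"
  have "range (\<lambda>x. \<pi> (\<tau>2 x)) = UNIV" using id by (metis surjI)
  then have "vec.dim (range (\<lambda>x. \<pi> (\<tau>2 x))) = 2 * CARD('n)"
    by (simp add: card_cart_basis)
  then have dimZ: "vec.dim Z + 2 * CARD('n) = CARD('m)"
    using rank_nullity[OF lin2] by (simp add: Z_def)
  obtain \<zeta> :: "('k ^ 'm \<Rightarrow> 'k) \<Rightarrow> 'k ^ 'm" and B where
    \<zeta>: "\<zeta> = (\<lambda>q. \<Sum>b\<in>B. q b *s b)" "finite B" "card B = vec.dim Z" "Z = range \<zeta>"
    by (rule subspace_parametrization[OF subspace_kernel[OF lin2], folded Z_def])
  define C where "C = (\<lambda>(q, \<mu>) s. det (\<chi> i j. if j = s then (- \<pi> (\<tau>1 (\<zeta> q))) $ i else A \<mu> $ i $ j))"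
  define \<psi> :: "('k ^ 'm \<Rightarrow> 'k) \<times> 'k \<Rightarrow> 'k ^ 'm" where
    "\<psi> = (\<lambda>(q, \<mu>). det (A \<mu>) *s \<zeta> q + (\<Sum>s\<in>UNIV. C (q, \<mu>) s *s \<iota> (axis s 1)))"
  \<comment> \<open>The generators are \<open>\<mu>\<close> and the \<open>m - 2 * n\<close>
    coordinates on \<open>Z\<close>; since \<open>n \<ge> 1\<close>, the extra parameter
    \<open>\<mu>\<close> still leaves \<open>card J \<le> m - n\<close>.\<close>
  define J where "J = insert snd ((\<lambda>b (p :: ('k ^ 'm \<Rightarrow> 'k) \<times> 'k). fst p b) ` B)"
  have "card J \<le> Suc (card B)"
    using card_image_le[OF \<zeta>(2), of "\<lambda>b (p :: ('k ^ 'm \<Rightarrow> 'k) \<times> 'k). fst p b"] \<zeta>(2)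
    by (auto simp: J_def card_insert_if)
  moreover have "0 < CARD('n)" by simp
  ultimately have cJ: "finite J" "card J + CARD('n) \<le> CARD('m)"
    using dimZ \<zeta>(2,3) by (simp add: J_def, linarith)
  have \<mu>J: "(\<lambda>p. snd p) \<in> polyfuns J" by (rule polyfuns_base) (auto simp: J_def)
  have qJ: "(\<lambda>p. fst p b) \<in> polyfuns J" if "b \<in> B" for b
    by (rule polyfuns_base) (use that in \<open>auto simp: J_def\<close>)
  have AJ: "(\<lambda>p. A (snd p) $ i $ j) \<in> polyfuns J" for i j
    by (cases "i = j") (auto simp: A_def intro!: polyfuns_intros \<mu>J)
  have detJ: "(\<lambda>p. det (A (snd p))) \<in> polyfuns J"
    using polyfuns_det[of "\<lambda>p i j. A (snd p) $ i $ j", OF AJ] by simp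
  have "\<pi> (\<tau>1 (\<zeta> q)) $ i = (\<Sum>b\<in>B. q b * \<pi> (\<tau>1 b) $ i)" for q i
    by (simp add: \<zeta>(1) l1.sum l1.scale \<pi>.sum \<pi>.scale)
  then have \<pi>J: "(\<lambda>p. \<pi> (\<tau>1 (\<zeta> (fst p))) $ i) \<in> polyfuns J" for i
    by (simp, intro polyfuns_intros qJ)
  have CJ: "(\<lambda>p. C p s) \<in> polyfuns J" for s
    unfolding C_def case_prod_beta vector_uminus_component
    by (intro polyfuns_det polyfuns_if polyfuns_minus \<pi>J AJ)
  have "(\<lambda>p. \<psi> p $ r) \<in> polyfuns J" for r
    unfolding \<psi>_def case_prod_beta \<zeta>(1)
    by (simp, intro polyfuns_intros detJ qJ CJ)
  from thin_meets[OF inf cJ this]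
  have thin: "thin {M :: 'm \<times> 'n \<Rightarrow> 'k. \<exists>a. (\<exists>i. a i = 1) \<and> comb M a \<in> range \<psi>}" .
  have \<psi>: "w \<in> range \<psi>" if w: "\<tau>1 w = \<mu> *s \<tau>2 w" and \<delta>: "det (A \<mu>) \<noteq> 0" for w \<mu>
  proof -
    define y where "y = \<pi> (\<tau>2 w)"
    define z where "z = w - \<iota> y"
    \<comment> \<open>The factor \<open>det (A \<mu>)\<close> in \<open>\<psi>\<close> is
      compensated by parametrizing \<open>c *s z\<close> instead of \<open>z\<close>.\<close>
    define c where "c = inverse (det (A \<mu>))"
    have "z \<in> Z" by (simp add: Z_def z_def y_def l2.diff \<pi>.diff id)
    then have "c *s z \<in> Z" by (simp add: Z_def l2.scale \<pi>.scale)
    then obtain q where q: "c *s z = \<zeta> q" unfolding \<zeta>(4) by blast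
    \<comment> \<open>Apply \<open>\<pi>\<close> to \<open>\<tau>1 w = \<mu> *s \<tau>2 w\<close>
      with \<open>w = \<iota> y + z\<close>.\<close>
    have "A \<mu> *v y = - \<pi> (\<tau>1 z)"
      by (simp add: A z_def l1.diff \<pi>.diff w \<pi>.scale y_def)
    then have "A \<mu> *v (c *s y) = - \<pi> (\<tau>1 (\<zeta> q))"
      by (simp add: q[symmetric] l1.scale \<pi>.scale vec.scale)
    then have "c *s y = (\<chi> s. C (q, \<mu>) s / det (A \<mu>))"
      unfolding cramer[OF \<delta>] by (simp add: C_def)
    then have y: "y $ s = C (q, \<mu>) s" for s
      using \<delta> by (simp add: vec_eq_iff c_def field_simps)
    have "\<iota> y = \<iota> (\<Sum>s\<in>UNIV. y $ s *s axis s 1)" by (simp only: basis_expansion)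
    also have "\<dots> = (\<Sum>s\<in>UNIV. C (q, \<mu>) s *s \<iota> (axis s 1))"
      by (simp only: \<iota>.sum \<iota>.scale y)
    finally have "\<iota> y = (\<Sum>s\<in>UNIV. C (q, \<mu>) s *s \<iota> (axis s 1))" .
    moreover have "z = det (A \<mu>) *s \<zeta> q"
      using \<delta> by (simp add: q[symmetric] c_def)
    ultimately have "w = \<psi> (q, \<mu>)" by (simp add: \<psi>_def z_def diff_eq_eq)
    then show ?thesis by blast
  qed
  show thesis
  proof (rule that)
    show "finite {\<mu>. det (A \<mu>) = 0}" unfolding A_def by (rule finite_singular_shifts[OF inf])
    show "thin {M :: 'm \<times> 'n \<Rightarrow> 'k. \<exists>a. (\<exists>i. a i = 1) \<and>
        (\<exists>\<mu>. \<mu> \<notin> {\<mu>. det (A \<mu>) = 0} \<and> \<tau>1 (comb M a) = \<mu> *s \<tau>2 (comb M a))}"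
      by (rule thin_subset[OF thin]) (use \<psi> in blast)
  qed
qed

text \<open>The pairs with \<open>\<tau>1 x1 = \<tau>2 x2\<close> form the kernel of a linear map
  \<open>T\<close> on the space of dimension \<open>2 * m\<close>; its image contains that of
  \<open>\<tau>2\<close>, so the kernel has dimension at most \<open>2 * m - 2 * n\<close>.
  Independence is asked of the coefficient vectors, with no assumption on the rank of
  \<open>M\<close>.\<close>

lemma thin_meets_independent_pair:
  fixes \<tau>1 \<tau>2 :: "'k::field ^ 'm::finite \<Rightarrow> 'k ^ 'm"
  assumes inf: "infinite (UNIV :: 'k set)"
    and l1: "Vector_Spaces.linear (*s) (*s) \<tau>1" and l2: "Vector_Spaces.linear (*s) (*s) \<tau>2"
    and r2: "2 * CARD('n::finite) \<le> vec.dim (range \<tau>2)"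
  shows "thin {M :: 'm \<times> 'n \<Rightarrow> 'k. \<exists>a b. \<tau>1 (comb M a) = \<tau>2 (comb M b) \<and>
    a \<noteq> (\<lambda>_. 0) \<and> (\<nexists>\<mu>. b = (\<lambda>l. \<mu> * a l))}" (is "thin ?S")
proof -
  interpret l1: Vector_Spaces.linear "(*s)" "(*s)" \<tau>1 by fact
  interpret l2: Vector_Spaces.linear "(*s)" "(*s)" \<tau>2 by fact
  define p1 where "p1 u = (\<chi> r. u $ Inl r)" for u :: "'k ^ ('m + 'm)"
  define p2 where "p2 u = (\<chi> r. u $ Inr r)" for u :: "'k ^ ('m + 'm)"
  define T where "T u = \<tau>1 (p1 u) - \<tau>2 (p2 u)" for u
  have p: "p1 (u + v) = p1 u + p1 v" "p2 (u + v) = p2 u + p2 v" "p1 (c *s u) = c *s p1 u"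
    "p2 (c *s u) = c *s p2 u" for u v c
    by (simp_all add: p1_def p2_def vec_eq_iff)
  have linT: "Vector_Spaces.linear (*s) (*s) T"
    by unfold_locales (simp_all add: T_def p l1.add l2.add l1.scale l2.scale algebra_simps)
  have "range \<tau>2 \<subseteq> range T"
  proof
    fix y assume "y \<in> range \<tau>2"
    then obtain x where x: "y = \<tau>2 x" by blast
    define u :: "'k ^ ('m + 'm)" where "u = (\<chi> s. case s of Inl r \<Rightarrow> 0 | Inr r \<Rightarrow> - x $ r)"
    have "p1 u = 0" "p2 u = - x" by (simp_all add: u_def p1_def p2_def vec_eq_iff)
    then have "y = T u" by (simp add: T_def x l2.neg)
    then show "y \<in> range T" by blast
  qed
  then have "2 * CARD('n) \<le> vec.dim (range T)" using r2 vec.dim_subset le_trans by blast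
  then have dimK: "vec.dim {u. T u = 0} + 2 * CARD('n) \<le> 2 * CARD('m)"
    using rank_nullity[OF linT] by (simp add: card_sum)
  obtain \<psi> :: "('k ^ ('m + 'm) \<Rightarrow> 'k) \<Rightarrow> 'k ^ ('m + 'm)" and B where
    \<psi>: "\<psi> = (\<lambda>q. \<Sum>b\<in>B. q b *s b)" "finite B" "card B = vec.dim {u. T u = 0}" "{u. T u = 0} = range \<psi>"
    by (rule subspace_parametrization[OF subspace_kernel[OF linT]])
  define J where "J = (\<lambda>b (q :: 'k ^ ('m + 'm) \<Rightarrow> 'k). q b) ` B"
  have "finite J" "card J \<le> card B"
    unfolding J_def using \<psi>(2) by (auto intro: card_image_le)
  then have J: "finite J" "card J + 2 * CARD('n) \<le> 2 * CARD('m)" using dimK \<psi>(3) by auto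
  have \<psi>J: "(\<lambda>q. \<psi> q $ r) \<in> polyfuns J" for r
    unfolding \<psi>(1) sum_component vector_smult_component
    by (intro polyfuns_intros polyfuns_base) (auto simp: J_def)
  have "thin {M :: 'm \<times> 'n \<Rightarrow> 'k. \<exists>a e i j c d q. i \<noteq> j \<and> a i = 1 \<and> e i = 0 \<and> e j = 1 \<and>
           comb M a = p1 (\<psi> q) \<and> comb M e = c *s (p2 (\<psi> q) - d *s p1 (\<psi> q))}" (is "thin ?S'")
    by (rule thin_meets_pair[OF inf J]) (simp_all add: p1_def p2_def \<psi>J)
  moreover have "?S \<subseteq> ?S'"
  proof clarify
    fix M :: "'m \<times> 'n \<Rightarrow> 'k" and a b
    assume ab: "\<tau>1 (comb M a) = \<tau>2 (comb M b)" and a: "a \<noteq> (\<lambda>_. 0)" and b: "\<nexists>\<mu>. b = (\<lambda>l. \<mu> * a l)"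
    obtain i where i: "a i \<noteq> 0" using a by auto
    \<comment> \<open>Normalization as in Gaussian elimination: make \<open>a'\<close> equal to 1 at
      \<open>i\<close>, clear the entry of \<open>b'\<close> at \<open>i\<close>, then scale the
      result to 1 at some \<open>j\<close>.\<close>
    define a' b' where "a' = (\<lambda>l. inverse (a i) * a l)" and "b' = (\<lambda>l. inverse (a i) * b l)"
    define u :: "'k ^ ('m + 'm)" where
      "u = (\<chi> s. case s of Inl r \<Rightarrow> comb M a' $ r | Inr r \<Rightarrow> comb M b' $ r)"
    have u: "p1 u = comb M a'" "p2 u = comb M b'"
      by (simp_all add: u_def p1_def p2_def vec_eq_iff)
    have "T u = 0" unfolding T_def u by (simp add: a'_def b'_def comb_scale l1.scale l2.scale ab)
    then obtain q where q: "u = \<psi> q" using \<psi>(4) by blast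
    define b'' where "b'' = (\<lambda>l. b' l - b' i * a' l)"
    have "b'' \<noteq> (\<lambda>_. 0)"
    proof
      assume "b'' = (\<lambda>_. 0)"
      then have eq: "b' l = b' i * a' l" for l 
        using fun_cong[of b'' _ l] unfolding b''_def by simp
      have "b l = b' i * a l" for l
      proof -
        have "b l = a i * b' l" using i by (simp add: b'_def)
        also have "\<dots> = b' i * (a i * a' l)" by (subst eq) (rule mult.left_commute)
        also have "a i * a' l = a l" using i by (simp add: a'_def)
        finally show ?thesis .
      qed
      then have "b = (\<lambda>l. b' i * a l)" by (rule ext)
      then show False using b by blast
    qed
    then obtain j where j: "b'' j \<noteq> 0" by auto
    define e where "e = (\<lambda>l. inverse (b'' j) * b'' l)"
    have "a' i = 1" using i by (simp add: a'_def)
    moreover from this have "b'' i = 0" by (simp add: b''_def)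
    moreover from this have "i \<noteq> j" "e i = 0" "e j = 1" using j by (auto simp: e_def)
    moreover have "comb M e = inverse (b'' j) *s (p2 (\<psi> q) - b' i *s p1 (\<psi> q))"
      unfolding e_def b''_def comb_scale comb_diff q[symmetric] u ..
    moreover have "comb M a' = p1 (\<psi> q)" by (simp add: u flip: q)
    ultimately show "\<exists>a e i j c d q. i \<noteq> j \<and> a i = 1 \<and> e i = 0 \<and> e j = 1 \<and>
           comb M a = p1 (\<psi> q) \<and> comb M e = c *s (p2 (\<psi> q) - d *s p1 (\<psi> q))" by blast
  qed
  ultimately show ?thesis by (rule thin_subset)
qed

text \<open>Assembles the cases \<open>a = 0\<close>, \<open>b = \<mu> * a\<close> and
  \<open>a\<close>, \<open>b\<close> independent. In the second, \<open>a \<noteq> b\<close> forces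
  \<open>\<mu> \<noteq> 1\<close>, so \<open>r\<close> applies to each of the finitely many
  exceptional \<open>\<mu>\<close>.\<close>

lemma thin_failing_matrices:
  fixes \<tau>1 \<tau>2 :: "'k::field ^ 'm::finite \<Rightarrow> 'k ^ 'm"
  assumes inf: "infinite (UNIV :: 'k set)"
    and l1: "Vector_Spaces.linear (*s) (*s) \<tau>1" and l2: "Vector_Spaces.linear (*s) (*s) \<tau>2"
    and r2: "2 * CARD('n::finite) \<le> vec.dim (range \<tau>2)"
    and r: "\<And>\<mu>. \<mu> \<noteq> 1 \<Longrightarrow> CARD('n) \<le> vec.dim (range (\<lambda>v. \<tau>1 v - \<mu> *s \<tau>2 v))"
  shows "thin {M :: 'm \<times> 'n \<Rightarrow> 'k. \<exists>a b. a \<noteq> b \<and> \<tau>1 (comb M a) = \<tau>2 (comb M b)}" (is "thin ?S")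
proof -
  interpret l1: Vector_Spaces.linear "(*s)" "(*s)" \<tau>1 by fact
  interpret l2: Vector_Spaces.linear "(*s)" "(*s)" \<tau>2 by fact
  let ?meets = "\<lambda>S. {M :: 'm \<times> 'n \<Rightarrow> 'k. \<exists>a. (\<exists>i. a i = 1) \<and> comb M a \<in> S}"
  obtain L where L: "finite L"
    "thin {M :: 'm \<times> 'n \<Rightarrow> 'k. \<exists>a. (\<exists>i. a i = 1) \<and> (\<exists>\<mu>. \<mu> \<notin> L \<and> \<tau>1 (comb M a) = \<mu> *s \<tau>2 (comb M a))}"
    (is "thin ?S1") by (rule thin_meets_pencil_kernels[OF inf l1 l2 r2])
  have lin: "Vector_Spaces.linear (*s) (*s) (\<lambda>v. \<tau>1 v - \<mu> *s \<tau>2 v)" for \<mu>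
    by unfold_locales (simp_all add: l1.add l2.add l1.scale l2.scale algebra_simps)
  have S2: "thin (?meets {v. \<tau>2 v = 0})"
    using rank_nullity[OF l2] r2
    by (intro thin_meets_subspace[OF inf subspace_kernel[OF l2]]) linarith
  have S3: "thin (\<Union>\<mu>\<in>L - {1}. ?meets {v. \<tau>1 v - \<mu> *s \<tau>2 v = 0})"
  proof (rule thin_UN[OF inf])
    fix \<mu> assume "\<mu> \<in> L - {1}"
    then have "CARD('n) \<le> vec.dim (range (\<lambda>v. \<tau>1 v - \<mu> *s \<tau>2 v))" using r by simp
    then show "thin (?meets {v. \<tau>1 v - \<mu> *s \<tau>2 v = 0})"
      using rank_nullity[OF lin, of \<mu>]
      by (intro thin_meets_subspace[OF inf subspace_kernel[OF lin]]) linarith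
  qed (simp add: L)
  note S4 = thin_meets_independent_pair[OF inf l1 l2 r2]
  have thin: "thin (?S1 \<union> (?meets {v. \<tau>2 v = 0} \<union> ((\<Union>\<mu>\<in>L - {1}. ?meets {v. \<tau>1 v - \<mu> *s \<tau>2 v = 0}) \<union>
     {M :: 'm \<times> 'n \<Rightarrow> 'k. \<exists>a b. \<tau>1 (comb M a) = \<tau>2 (comb M b) \<and>
       a \<noteq> (\<lambda>_. 0) \<and> (\<nexists>\<mu>. b = (\<lambda>l. \<mu> * a l))})))" (is "thin ?U")
    by (intro thin_Un[OF inf] L(2) S2 S3 S4)
  \<comment> \<open>The relations are homogeneous, so a nonzero coefficient vector may be scaled to
    have an entry 1, as the thin sets above require.\<close>
  have normalize: "\<exists>c. c \<noteq> 0 \<and> (\<exists>i. c * a i = 1)" if "a \<noteq> (\<lambda>_. 0)" for a :: "'n \<Rightarrow> 'k"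
  proof -
    obtain i where "a i \<noteq> 0" using \<open>a \<noteq> _\<close> by auto
    then show ?thesis by (intro exI[of _ "inverse (a i)"] conjI exI[of _ i]) auto
  qed
  have "M \<in> ?U" if M: "M \<in> ?S" for M
  proof -
    obtain a b where ab: "a \<noteq> b" "\<tau>1 (comb M a) = \<tau>2 (comb M b)"
      using M by blast
    consider "a = (\<lambda>_. 0)" | \<mu> where "a \<noteq> (\<lambda>_. 0)" "b = (\<lambda>l. \<mu> * a l)"
      | "a \<noteq> (\<lambda>_. 0)" "\<nexists>\<mu>. b = (\<lambda>l. \<mu> * a l)" by blast
    then show ?thesis
    proof cases
      case 1
      then obtain c i where c: "c * b i = 1" using ab(1) normalize[of b] by auto
      have "comb M a = 0" using 1 by (simp add: comb_def vec_eq_iff)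
      then have "\<tau>2 (comb M (\<lambda>l. c * b l)) = 0"
        using ab(2) by (simp add: comb_scale l2.scale)
      then have "M \<in> ?meets {v. \<tau>2 v = 0}" using c by (intro CollectI exI[of _ "\<lambda>l. c * b l"]) auto
      then show ?thesis by blast
    next
      case (2 \<mu>)
      obtain c i where c: "c * a i = 1" using 2(1) normalize[of a] by auto
      have \<mu>: "\<mu> \<noteq> 1" using ab(1) 2(2) by auto
      have eq: "\<tau>1 (comb M (\<lambda>l. c * a l)) = \<mu> *s \<tau>2 (comb M (\<lambda>l. c * a l))"
        using ab(2) by (simp add: 2(2) comb_scale l1.scale l2.scale mult.commute)
      show ?thesis
      proof (cases "\<mu> \<in> L")
        case True
        have "M \<in> ?meets {v. \<tau>1 v - \<mu> *s \<tau>2 v = 0}"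
          using c eq by (intro CollectI exI[of _ "\<lambda>l. c * a l"]) auto
        then show ?thesis using True \<mu> by blast
      next
        case False
        then have "M \<in> ?S1" using c eq by (intro CollectI exI[of _ "\<lambda>l. c * a l"]) auto
        then show ?thesis by blast
      qed
    next
      case 3
      then show ?thesis using ab(2) by blast
    qed
  qed
  then have "?S \<subseteq> ?U" by (rule subsetI)
  with thin show ?thesis by (rule thin_subset)
qed

section \<open>Open dense subsets of the Grassmannian\<close>

lemma meval_mvar [simp]: "meval x (mvar i) = x i" for x :: "'i::finite \<Rightarrow> 'k::comm_ring_1"
proof -
  have "(\<Prod>j\<in>UNIV. x j ^ Poly_Mapping.lookup (Poly_Mapping.single i 1) j) = x i"
    by (simp add: lookup_single when_def if_distrib[of "\<lambda>n. _ ^ n"] prod.If_cases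
        flip: Collect_conj_eq)
  then show ?thesis by (simp add: mvar_def meval_single)
qed

lemma meval_mconst [simp]: "meval x (mconst c) = c"
  by (simp add: mconst_def meval_single)

lemma meval_sum: "meval x (\<Sum>i\<in>A. f i) = (\<Sum>i\<in>A. meval x (f i))"
  by (induction A rule: infinite_finite_induct) (auto simp: meval_add)

lemma meval_prod: "meval x (\<Prod>i\<in>A. f i) = (\<Prod>i\<in>A. meval x (f i))"
  by (induction A rule: infinite_finite_induct) (auto simp: meval_mult)

lemma meval_power: "meval x (f ^ n) = meval x f ^ n"
  by (induction n) (auto simp: meval_mult)

lemma meval_diff: "meval x (f - g) = meval x f - meval x g"
  using meval_add[of x "f - g" g] by simp

lemma homogeneous_0 [simp]: "homogeneous d 0"
  by (simp add: homogeneous_def)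

lemma homogeneous_add: "homogeneous d p \<Longrightarrow> homogeneous d q \<Longrightarrow> homogeneous d (p + q)"
  unfolding homogeneous_def using keys_add[of p q] by blast

lemma homogeneous_sum: "(\<And>i. i \<in> A \<Longrightarrow> homogeneous d (f i)) \<Longrightarrow> homogeneous d (\<Sum>i\<in>A. f i)"
  by (induction A rule: infinite_finite_induct) (auto intro: homogeneous_add)

lemma homogeneous_mconst: "homogeneous 0 (mconst c)"
  by (simp add: homogeneous_def mconst_def)

lemma homogeneous_mvar: "homogeneous 1 (mvar i)"
  by (simp add: homogeneous_def mvar_def lookup_single when_def)

lemma homogeneous_power: "homogeneous d p \<Longrightarrow> homogeneous (n * d) (p ^ n)"
proof (induction n)
  case 0
  then show ?case by (simp add: homogeneous_def)
next
  case (Suc n)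
  then show ?case using homogeneous_mult[of d p "n * d" "p ^ n"] by simp
qed

lemma homogeneous_prod:
  "(\<And>i. i \<in> A \<Longrightarrow> homogeneous (d i) (f i)) \<Longrightarrow> homogeneous (\<Sum>i\<in>A. d i) (\<Prod>i\<in>A. f i)"
proof (induction A rule: infinite_finite_induct)
  case (insert i A)
  then show ?case using homogeneous_mult[of "d i" "f i" "sum d A" "prod f A"] by simp
qed (simp_all add: homogeneous_def)

text \<open>Clearing denominators: a monomial of total degree \<open>e\<close> is padded by
  \<open>l0 ^ (d - e)\<close>. The induction provides every sufficiently large \<open>d\<close>, so
  that summands can be brought to one degree.\<close>

lemma homogeneous_substitution:
  fixes G :: "('i::finite, 'k::field) mpoly" and l :: "'i \<Rightarrow> ('j::finite, 'k) mpoly"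
  assumes l: "\<And>i. homogeneous 1 (l i)" and l0: "homogeneous 1 l0"
  obtains F d where "homogeneous d F"
    "\<And>x. meval x l0 \<noteq> 0 \<Longrightarrow> meval x F = meval x l0 ^ d * meval (\<lambda>i. meval x (l i) / meval x l0) G"
proof -
  have "\<exists>d0. \<forall>d\<ge>d0. \<exists>F. homogeneous d F \<and> (\<forall>x. meval x l0 \<noteq> 0 \<longrightarrow>
      meval x F = meval x l0 ^ d * meval (\<lambda>i. meval x (l i) / meval x l0) G)"
  proof (induction G rule: mpoly_induct)
    case zero
    show ?case by (intro exI[of _ 0] allI impI) simp
  next
    case (add p t c)
    then obtain d0 where d0: "\<And>d. d \<ge> d0 \<Longrightarrow> \<exists>F. homogeneous d F \<and> (\<forall>x. meval x l0 \<noteq> 0 \<longrightarrow>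
      meval x F = meval x l0 ^ d * meval (\<lambda>i. meval x (l i) / meval x l0) p)" by blast
    let ?t = "\<Sum>i\<in>UNIV. Poly_Mapping.lookup t i"
    show ?case
    proof (intro exI[of _ "max d0 ?t"] allI impI)
      fix d assume d: "max d0 ?t \<le> d"
      then obtain F where F: "homogeneous d F" "\<And>x. meval x l0 \<noteq> 0 \<Longrightarrow>
        meval x F = meval x l0 ^ d * meval (\<lambda>i. meval x (l i) / meval x l0) p"
        using d0 by (meson max.boundedE)
      define H where "H = mconst c * (\<Prod>i\<in>UNIV. l i ^ Poly_Mapping.lookup t i) * l0 ^ (d - ?t)"
      have "homogeneous (0 + (\<Sum>i\<in>UNIV. Poly_Mapping.lookup t i * 1) + (d - ?t) * 1) H"
        unfolding H_def
        by (intro homogeneous_mult homogeneous_mconst homogeneous_prod homogeneous_power l l0)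
      then have "homogeneous d H" using d by simp
      moreover have "meval x H = meval x l0 ^ d *
          meval (\<lambda>i. meval x (l i) / meval x l0) (Poly_Mapping.single t c)"
        if nz: "meval x l0 \<noteq> 0" for x
      proof -
        have "(\<Prod>i\<in>UNIV. meval x l0 ^ Poly_Mapping.lookup t i) = meval x l0 ^ ?t"
          by (simp add: power_sum)
        moreover have "meval x l0 ^ d = meval x l0 ^ ?t * meval x l0 ^ (d - ?t)"
          using d by (simp flip: power_add)
        ultimately show ?thesis using nz
          by (simp add: H_def meval_mult meval_prod meval_power meval_single power_divide prod_dividef)
      qed
      ultimately show "\<exists>F. homogeneous d F \<and> (\<forall>x. meval x l0 \<noteq> 0 \<longrightarrow> meval x F =
          meval x l0 ^ d * meval (\<lambda>i. meval x (l i) / meval x l0) (p + Poly_Mapping.single t c))"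
        using F by (intro exI[of _ "F + H"])
          (auto intro: homogeneous_add simp: meval_add distrib_left)
    qed
  qed
  then show thesis using that by blast
qed

section \<open>Column spaces, Pluecker coordinates and an affine chart\<close>

lemma range_matrix_vector_mult: "range ((*v) B) = vec.span (columns B)"
  for B :: "'k::field ^ 'n::finite ^ 'm::finite"
proof
  show "range ((*v) B) \<subseteq> vec.span (columns B)"
  proof clarify
    fix x
    show "B *v x \<in> vec.span (columns B)"
      unfolding matrix_mult_sum
      by (intro vec.span_sum vec.span_scale vec.span_base) (auto simp: columns_def)
  qed
  have "column i B = B *v axis i 1" for i
    by (simp add: vec_eq_iff column_def matrix_vector_mult_def axis_def if_distrib cong: if_cong)
  then have "columns B \<subseteq> range ((*v) B)" by (auto simp: columns_def)
  moreover have "vec.subspace (range ((*v) B))"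
    using vec.subspace_image[OF vec.subspace_UNIV] by blast
  ultimately show "vec.span (columns B) \<subseteq> range ((*v) B)" by (rule vec.span_minimal)
qed

text \<open>A nonzero maximal minor makes multiplication by \<open>B\<close> injective.\<close>

lemma span_columns_in_Gr:
  fixes B :: "'k::field ^ 'n::finite ^ 'm::finite"
  assumes "pluecker B s \<noteq> 0"
  shows "vec.span (columns B) \<in> Gr TYPE('n)"
proof -
  let ?B = "\<chi> i. B $ s i"
  have "inj ((*v) B)"
  proof (rule injI)
    fix x y assume eq: "B *v x = B *v y"
    have "(?B *v z) $ i = (B *v z) $ s i" for z i by (simp add: matrix_vector_mult_def)
    then have "?B *v x = ?B *v y" by (simp add: vec_eq_iff eq)
    moreover have "invertible ?B" using assms by (simp add: pluecker_def invertible_det_nz)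
    ultimately show "x = y" by (metis invertible_def matrix_vector_mul_assoc matrix_vector_mul_lid)
  qed
  then have "vec.dim (range ((*v) B)) = vec.dim (UNIV :: ('k ^ 'n) set)"
    by (intro vec.dim_image_eq) auto
  then show ?thesis
    by (simp add: Gr_def range_matrix_vector_mult card_cart_basis)
qed

lemma
  fixes A :: "'k::field ^ 'n::finite ^ 'n"
  assumes "invertible A"
  shows matrix_inv_right: "A ** matrix_inv A = mat 1" and matrix_inv_left: "matrix_inv A ** A = mat 1"
  using someI_ex[OF assms[unfolded invertible_def]] unfolding matrix_inv_def by auto

text \<open>Cramer's rule for the normal form of \<open>B\<close> that has the identity in rows
  \<open>s\<close>: its row \<open>i\<close> lists the coefficients of row \<open>i\<close> of
  \<open>B\<close> in the rows of the block, and \<open>s(l := i)\<close> replaces row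
  \<open>l\<close> of the minor.\<close>

lemma pluecker_quotient:
  fixes B :: "'k::field ^ 'n::finite ^ 'm::finite"
  assumes nz: "pluecker B s \<noteq> 0"
  shows "(B ** matrix_inv (\<chi> i. B $ s i)) $ i $ l = pluecker B (s(l := i)) / pluecker B s"
proof -
  define A where "A = (\<chi> i. B $ s i)"
  have inv: "invertible A" using nz by (simp add: A_def pluecker_def invertible_det_nz)
  define C where "C = B ** matrix_inv A"
  have "C ** A = B"
    unfolding C_def using inv by (metis matrix_inv_left matrix_mul_assoc matrix_mul_rid)
  then have sum: "(\<Sum>l\<in>UNIV. C $ i $ l *s row l A) = B $ i"
    by (auto simp: vec_eq_iff matrix_matrix_mult_def row_def)
  have "C $ i $ l * det A = det (\<chi> l'. if l' = l then B $ i else row l' A)"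
    using cramer_lemma_transpose[where k = l and x = "C $ i" and A = A] unfolding sum by (rule sym)
  also have "(\<chi> l'. if l' = l then B $ i else row l' A) = (\<chi> l'. B $ (s(l := i)) l')"
    by (simp add: vec_eq_iff A_def row_def)
  finally show ?thesis using nz by (simp add: pluecker_def A_def C_def field_simps)
qed

text \<open>On the chart where coordinate \<open>s\<close> is nonzero, \<open>V\<close> has the
  basis matrix \<open>N B\<close>, whose entries are linear forms in the Pluecker coordinates
  divided by coordinate \<open>s\<close>. Homogenizing \<open>G\<close> at these entries gives
  \<open>F\<close>, and \<open>F \<noteq> 0\<close> keeps \<open>N B\<close> outside
  \<open>bad\<close>.\<close>

lemma open_dense_avoiding_thin:
  fixes bad :: "('m::finite \<times> 'n::finite \<Rightarrow> 'k::field) set"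
  assumes inf: "infinite (UNIV :: 'k set)" and le: "CARD('n) \<le> CARD('m)" and thin: "thin bad"
  obtains \<U> :: "('k ^ 'm) set set" where "openin (Gr_zariski TYPE('n)) \<U>"
    "Gr_zariski TYPE('n) closure_of \<U> = Gr TYPE('n)"
    "\<And>V. V \<in> \<U> \<Longrightarrow> \<exists>M. M \<notin> bad \<and> V = range (comb M)"
proof -
  define mat_of where "mat_of x = (\<chi> i j. x (i, j))" for x :: "'m \<times> 'n \<Rightarrow> 'k"
  obtain G x1 where G: "meval x1 G \<noteq> 0" "\<And>x. x \<in> bad \<Longrightarrow> meval x G = 0"
    using thin unfolding thin_def by blast
  obtain s :: "'n \<Rightarrow> 'm" where s: "inj s"
    using card_le_inj[of "UNIV :: 'n set" "UNIV :: 'm set"] le by auto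
  have pf: "(\<lambda>x. meval (pluecker (mat_of x)) F) \<in> polyfuns coords" for F :: "('n \<Rightarrow> 'm, 'k) mpoly"
    unfolding pluecker_def mat_of_def
    by (intro polyfuns_meval, simp, intro polyfuns_det polyfuns_base) auto
  \<comment> \<open>This matrix has the identity in rows \<open>s\<close>, so the chart has a
    point.\<close>
  have "pluecker (mat_of (\<lambda>(i, j). if i = s j then 1 else 0)) s = 1"
  proof -
    have "(\<chi> i. mat_of (\<lambda>(i, j). if i = s j then 1 else 0) $ s i) = mat 1"
      using s by (auto simp: vec_eq_iff mat_of_def mat_def inj_eq)
    then show ?thesis by (simp add: pluecker_def det_I)
  qed
  then have nz: "meval (pluecker (mat_of (\<lambda>(i, j). if i = s j then 1 else 0))) (mvar s) \<noteq> 0" by simp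
  obtain x0 where x0: "meval x0 G \<noteq> 0" "meval (pluecker (mat_of x0)) (mvar s) \<noteq> 0"
    by (rule polyfuns_common_nonzero[where f = "\<lambda>x. meval x G" and
          g = "\<lambda>x. meval (pluecker (mat_of x)) (mvar s)", OF inf meval_polyfuns G(1) pf nz])
  \<comment> \<open>The normal form is twisted by the block of a matrix \<open>x0\<close> at which
    \<open>G\<close> is nonzero; with the identity block instead, \<open>G\<close> could vanish on
    all normal forms.\<close>
  define g where "g = (\<chi> i. mat_of x0 $ s i)"
  define l where "l = (\<lambda>(i, j). \<Sum>h\<in>UNIV. mconst (g $ h $ j) * (mvar (s(h := i)) :: ('n \<Rightarrow> 'm, 'k) mpoly))"
  have hl: "homogeneous 1 (l ij)" for ij
  proof -
    have "homogeneous (0 + 1) (mconst (g $ h $ j) * (mvar (s(h := i)) :: ('n \<Rightarrow> 'm, 'k) mpoly))" for h i j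
      by (intro homogeneous_mult homogeneous_mconst homogeneous_mvar)
    then show ?thesis by (auto simp: l_def intro: homogeneous_sum split: prod.split)
  qed
  obtain F d where F: "homogeneous d F" "\<And>x. meval x (mvar s) \<noteq> 0 \<Longrightarrow>
      meval x F = meval x (mvar s) ^ d * meval (\<lambda>i. meval x (l i) / meval x (mvar s)) G"
    by (rule homogeneous_substitution[of l "mvar s" G, OF hl homogeneous_mvar]) blast
  define N where "N B = B ** (matrix_inv (\<chi> i. B $ s i) ** g)" for B :: "'k ^ 'n ^ 'm"
  have N: "meval (pluecker B) (l ij) / meval (pluecker B) (mvar s) = N B $ fst ij $ snd ij"
    if "pluecker B s \<noteq> 0" for B ij
    unfolding N_def matrix_mul_assoc
    by (simp add: l_def case_prod_beta meval_sum meval_mult matrix_matrix_mult_def[of _ g]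
        pluecker_quotient[OF that] sum_divide_distrib mult_ac)
  have FG: "meval (pluecker B) F = pluecker B s ^ d * meval (\<lambda>(i, j). N B $ i $ j) G"
    if "pluecker B s \<noteq> 0" for B
  proof -
    have "(\<lambda>(i, j). N B $ i $ j) = (\<lambda>ij. N B $ fst ij $ snd ij)" by (simp add: fun_eq_iff)
    then show ?thesis using F(2)[of "pluecker B"] N[OF that] that by simp
  qed
  \<comment> \<open>The factor \<open>mvar s\<close> confines the open set to the chart.\<close>
  define \<U> where "\<U> = Gr TYPE('n) - Gr_zero_set {F * mvar s}"
  have g: "invertible g" using x0(2) by (simp add: g_def pluecker_def invertible_det_nz)
  show thesis
  proof (rule that)
    have "homogeneous (d + 1) (F * mvar s)" by (intro homogeneous_mult F homogeneous_mvar)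
    then show "openin (Gr_zariski TYPE('n)) \<U>"
      unfolding openin_Gr_zariski \<U>_def by (intro exI[of _ "{F * mvar s}"]) auto
  next
    fix V assume "V \<in> \<U>"
    then obtain B :: "'k ^ 'n ^ 'm" where V: "vec.span (columns B) = V"
      and nz: "meval (pluecker B) (F * mvar s) \<noteq> 0"
      unfolding \<U>_def Gr_zero_set_def by blast
    then have ps: "pluecker B s \<noteq> 0" and nF: "meval (pluecker B) F \<noteq> 0"
      by (auto simp: meval_mult)
    define A where "A = matrix_inv (\<chi> i. B $ s i) ** g"
    have "invertible (\<chi> i. B $ s i)" using ps by (simp add: pluecker_def invertible_det_nz)
    then have "invertible (matrix_inv (\<chi> i. B $ s i))"
      by (metis invertible_def matrix_inv_left matrix_inv_right)
    \<comment> \<open>Multiplying \<open>B\<close> by an invertible matrix on the right keeps its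
      column space.\<close>
    then have "invertible A" unfolding A_def using g invertible_mult by blast
    then have surj: "range ((*v) A) = UNIV"
      by (metis invertible_def matrix_vector_mul_assoc matrix_vector_mul_lid surjI)
    let ?M = "\<lambda>(i, j). N B $ i $ j"
    have "comb ?M a = N B *v (\<chi> j. a j)" for a
      by (simp add: comb_def vec_eq_iff matrix_vector_mult_def mult.commute)
    then have "range (comb ?M) = range (\<lambda>a. N B *v (\<chi> j. a j))" by presburger
    also have "\<dots> = range ((*v) (N B))"
    proof -
      have "N B *v x \<in> range (\<lambda>a. N B *v (\<chi> j. a j))" for x
        by (rule range_eqI[of _ _ "\<lambda>j. x $ j"]) simp
      then show ?thesis by auto
    qed
    also have "\<dots> = (*v) B ` range ((*v) A)"
      by (simp add: N_def A_def image_image matrix_vector_mul_assoc)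
    also have "\<dots> = V" unfolding surj using V by (simp add: range_matrix_vector_mult)
    finally have "V = range (comb ?M)" ..
    moreover have "?M \<notin> bad" using G(2) nF FG[OF ps] by auto
    ultimately show "\<exists>M. M \<notin> bad \<and> V = range (comb M)" by blast
  next
    have ps: "pluecker (mat_of x0) s \<noteq> 0" using x0(2) by simp
    \<comment> \<open>The block of \<open>x0\<close> in rows \<open>s\<close> is \<open>g\<close>,
      so \<open>x0\<close> is its own twisted normal form.\<close>
    have "N (mat_of x0) = mat_of x0"
      unfolding N_def using g by (simp add: g_def[symmetric] matrix_inv_left)
    then have "(\<lambda>(i, j). N (mat_of x0) $ i $ j) = x0" by (auto simp: mat_of_def)
    then have nz0: "meval (pluecker (mat_of x0)) (F * mvar s) \<noteq> 0"
      using FG[OF ps] ps x0(1) by (simp add: meval_mult)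
    \<comment> \<open>Both open sets are met where a polynomial in the matrix entries is nonzero; a
      common nonzero gives a matrix whose column space lies in both.\<close>
    have "\<U> \<inter> W \<noteq> {}" if W: "openin (Gr_zariski TYPE('n)) W" "W \<noteq> {}" for W
    proof -
      obtain S :: "('n \<Rightarrow> 'm, 'k) mpoly set" where S: "W = Gr TYPE('n) - Gr_zero_set S"
        using W(1) unfolding openin_Gr_zariski by blast
      then obtain E and B :: "'k ^ 'n ^ 'm" where E: "E \<in> S" "meval (pluecker B) E \<noteq> 0"
        using W(2) unfolding Gr_zero_set_def by blast
      have "B = mat_of (\<lambda>(i, j). B $ i $ j)" by (simp add: mat_of_def vec_eq_iff)
      then have nzB: "meval (pluecker (mat_of (\<lambda>(i, j). B $ i $ j))) E \<noteq> 0" using E(2) by simp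
      obtain x where x: "meval (pluecker (mat_of x)) (F * mvar s) \<noteq> 0"
        "meval (pluecker (mat_of x)) E \<noteq> 0"
        by (rule polyfuns_common_nonzero[where f = "\<lambda>x. meval (pluecker (mat_of x)) (F * mvar s)"
            and g = "\<lambda>x. meval (pluecker (mat_of x)) E", OF inf pf nz0 pf nzB])
      then have "pluecker (mat_of x) s \<noteq> 0" by (auto simp: meval_mult)
      then have "vec.span (columns (mat_of x)) \<in> Gr TYPE('n)" by (rule span_columns_in_Gr)
      then have "vec.span (columns (mat_of x)) \<in> \<U> \<inter> W"
        using x E(1) unfolding \<U>_def S Gr_zero_set_def by blast
      then show ?thesis by blast
    qed
    then show "Gr_zariski TYPE('n) closure_of \<U> = Gr TYPE('n)"
      using dense_intersects_open[of "Gr_zariski TYPE('n)" \<U>] by (simp add: topspace_Gr_zariski)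
  qed
qed

section \<open>Chains of primes in the determinantal locus\<close>

lemma topspace_Spec:
  assumes "cring R"
  shows "topspace (Spec R) = prime_spectrum R"
proof -
  interpret cring R by fact
  have "spec_zero_set R {\<one>\<^bsub>R\<^esub>} = {}"
    by (auto simp: spec_zero_set_def prime_spectrum_def)
       (metis ideal.one_imp_carrier primeideal.I_notcarr primeideal.axioms(1))
  then have "openin (Spec R) (prime_spectrum R)"
    unfolding openin_Spec[OF assms] by (intro exI[of _ "{\<one>\<^bsub>R\<^esub>}"]) auto
  moreover have "W \<subseteq> prime_spectrum R" if "openin (Spec R) W" for W
    using that unfolding openin_Spec[OF assms] by blast
  ultimately show ?thesis by (meson openin_subset openin_topspace subset_antisym)
qed

lemma closedin_Spec_subspace:
  assumes R: "cring R" and U: "U \<subseteq> prime_spectrum R"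
  shows "closedin (subtopology (Spec R) U) Z \<longleftrightarrow> (\<exists>S\<subseteq>carrier R. Z = spec_zero_set R S \<inter> U)"
proof -
  have sub: "spec_zero_set R S \<subseteq> prime_spectrum R" for S by (auto simp: spec_zero_set_def)
  have closed: "closedin (Spec R) C \<longleftrightarrow> (\<exists>S\<subseteq>carrier R. C = spec_zero_set R S)" for C
  proof
    assume "closedin (Spec R) C"
    then obtain S where "C \<subseteq> prime_spectrum R" "S \<subseteq> carrier R"
      "prime_spectrum R - C = prime_spectrum R - spec_zero_set R S"
      unfolding closedin_def topspace_Spec[OF R] openin_Spec[OF R] by blast
    then show "\<exists>S\<subseteq>carrier R. C = spec_zero_set R S" using sub[of S] by blast
  next
    assume "\<exists>S\<subseteq>carrier R. C = spec_zero_set R S"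
    then show "closedin (Spec R) C"
      unfolding closedin_def topspace_Spec[OF R] openin_Spec[OF R] using sub by blast
  qed
  show ?thesis unfolding closedin_subtopology closed by auto
qed

text \<open>The closure of \<open>P i\<close> in \<open>U\<close> is irreducible because
  \<open>P i\<close> is its generic point: a closed set containing \<open>P i\<close> contains all
  of \<open>Z i\<close>. Descending primes give ascending closures, strictly, since
  \<open>P (Suc i)\<close> is not in \<open>Z i\<close>.\<close>

lemma krull_dim_ge_chain:
  assumes R: "cring R" and U: "U \<subseteq> prime_spectrum R"
    and P: "\<And>i. i \<le> d \<Longrightarrow> P i \<in> U" and chain: "\<And>i. i < d \<Longrightarrow> P (Suc i) \<subset> P i"
  shows "ereal (real d) \<le> krull_dim (subtopology (Spec R) U)"
proof -
  define Z where "Z i = spec_zero_set R (P i) \<inter> U" for i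
  have car: "P i \<subseteq> carrier R" if "i \<le> d" for i
    using P[OF that] U additive_subgroup.a_subset
    by (fastforce simp: prime_spectrum_def primeideal_def ideal_def)
  have PZ: "P i \<in> Z i" if "i \<le> d" for i
    using P[OF that] U by (auto simp: Z_def spec_zero_set_def)
  have "irreducible_closedin (subtopology (Spec R) U) (Z i)" if i: "i \<le> d" for i
    unfolding irreducible_closedin_def
  proof (intro conjI allI impI)
    show "closedin (subtopology (Spec R) U) (Z i)"
      unfolding closedin_Spec_subspace[OF R U] Z_def using car[OF i] by blast
    show "Z i \<noteq> {}" using PZ[OF i] by blast
  next
    fix A B
    assume A: "closedin (subtopology (Spec R) U) A" and B: "closedin (subtopology (Spec R) U) B"
      and AB: "Z i = A \<union> B"
    have sub: "Z i \<subseteq> C" if "closedin (subtopology (Spec R) U) C" "P i \<in> C" for C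
      using that unfolding closedin_Spec_subspace[OF R U]
      by (auto simp: Z_def spec_zero_set_def)
    show "Z i = A \<or> Z i = B" using sub[OF A] sub[OF B] AB PZ[OF i] by blast
  qed
  moreover have "Z i \<subset> Z (Suc i)" if i: "i < d" for i
  proof
    show "Z i \<subseteq> Z (Suc i)" using chain[OF i] by (auto simp: Z_def spec_zero_set_def)
    have "P (Suc i) \<notin> Z i" using chain[OF i] by (auto simp: Z_def spec_zero_set_def)
    then show "Z i \<noteq> Z (Suc i)" using PZ[of "Suc i"] i by auto
  qed
  ultimately show ?thesis unfolding krull_dim_def by (intro Sup_upper) blast
qed

section \<open>Vanishing ideals of affine subspaces\<close>

lemma primeideal_vanishing_ideal_affine:
  fixes L :: "('k::field ^ 'm::finite) set"
  assumes inf: "infinite (UNIV :: 'k set)" and L: "vec.subspace L"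
  shows "primeideal (vanishing_ideal ((+) p ` L)) (mpoly_ring :: ('m, 'k) mpoly ring)"
proof (rule primeidealI)
  let ?I = "vanishing_ideal ((+) p ` L)"
  let ?R = "mpoly_ring :: ('m, 'k) mpoly ring"
  note R = ring_of_type_algebra_def
  have 0: "0 \<in> L" using L vec.subspace_0 by blast
  have neg: "meval x (- f) = - meval x f" for x and f :: "('m, 'k) mpoly"
    using meval_diff[of x 0 f] by simp
  show cr: "cring ?R" ..
  interpret cring ?R by (rule cr)
  show "ideal ?I ?R"
  proof (rule idealI)
    show "subgroup ?I (add_monoid ?R)"
    proof (rule add.subgroupI)
      fix f assume "f \<in> ?I"
      moreover have "\<ominus>\<^bsub>?R\<^esub> f = - f"
        by (rule minus_equality) (simp_all add: R)
      ultimately show "\<ominus>\<^bsub>?R\<^esub> f \<in> ?I" by (simp add: vanishing_ideal_def neg)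
    next
      show "?I \<noteq> {}" by (auto simp: vanishing_ideal_def intro!: exI[of _ 0])
    qed (auto simp: R vanishing_ideal_def meval_add)
  qed (rule ring_axioms, auto simp: R vanishing_ideal_def meval_mult)
  have "1 \<notin> ?I" using 0 by (auto simp: vanishing_ideal_def)
  then show "carrier ?R \<noteq> ?I" by (auto simp: R)
  fix f g assume "f \<otimes>\<^bsub>?R\<^esub> g \<in> ?I"
  then have fg: "f * g \<in> ?I" by (simp add: R)
  show "f \<in> ?I \<or> g \<in> ?I"
  proof (rule ccontr)
    assume "\<not> (f \<in> ?I \<or> g \<in> ?I)"
    then obtain v w where v: "v \<in> L" "meval (\<lambda>i. (p + v) $ i) f \<noteq> 0"
      and w: "w \<in> L" "meval (\<lambda>i. (p + w) $ i) g \<noteq> 0"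
      unfolding vanishing_ideal_def by blast
    obtain t where t: "meval (\<lambda>i. (p + v) $ i + t * ((p + w) $ i - (p + v) $ i)) f \<noteq> 0"
      "meval (\<lambda>i. (p + v) $ i + t * ((p + w) $ i - (p + v) $ i)) g \<noteq> 0"
      by (rule polyfuns_common_nonzero[where f = "\<lambda>x. meval x f" and g = "\<lambda>x. meval x g",
            OF inf meval_polyfuns v(2) meval_polyfuns w(2)])
    \<comment> \<open>The line joining \<open>p + v\<close> and \<open>p + w\<close> stays in the
      affine subspace, and at the parameter \<open>t\<close> neither factor vanishes.\<close>
    let ?u = "v + t *s (w - v)"
    have "?u \<in> L" using L v(1) w(1)
      by (intro vec.subspace_add vec.subspace_scale vec.subspace_diff)
    then have "meval (\<lambda>i. (p + ?u) $ i) (f * g) = 0"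
      using fg unfolding vanishing_ideal_def by blast
    moreover have "(\<lambda>i. (p + ?u) $ i) = (\<lambda>i. (p + v) $ i + t * ((p + w) $ i - (p + v) $ i))"
      by (simp add: fun_eq_iff algebra_simps)
    ultimately show False using t by (simp add: meval_mult)
  qed
qed

lemma linear_form_mpoly:
  fixes f :: "'k::field ^ 'm::finite \<Rightarrow> 'k ^ 'l::finite"
  assumes "Vector_Spaces.linear (*s) (*s) f"
  obtains q :: "('m, 'k) mpoly" where "\<And>v. meval (\<lambda>i. v $ i) q = f v $ r"
proof
  fix v
  have "f v $ r = (matrix f *v v) $ r" by (simp add: matrix_works[OF assms])
  then show "meval (\<lambda>i. v $ i) (\<Sum>j\<in>UNIV. mconst (matrix f $ r $ j) * mvar j) = f v $ r"
    by (simp add: meval_sum meval_mult matrix_vector_mult_def)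
qed

text \<open>Some coordinate of \<open>f\<close> is a linear form that vanishes on the kernel but not
  at \<open>p\<close>.\<close>

lemma not_in_subspace_closure:
  fixes f :: "'k::field ^ 'm::finite \<Rightarrow> 'k ^ 'l::finite"
  assumes f: "Vector_Spaces.linear (*s) (*s) f" and p: "f p \<noteq> 0" "p \<in> S"
  shows "vanishing_ideal S \<notin> subspace_closure {v. f v = 0}"
proof -
  obtain r where r: "f p $ r \<noteq> 0" using p(1) by (auto simp: vec_eq_iff)
  obtain q :: "('m, 'k) mpoly" where q: "\<And>v. meval (\<lambda>i. v $ i) q = f v $ r"
    using linear_form_mpoly[OF f] by blast
  have "q \<in> vanishing_ideal {v. f v = 0}" by (simp add: vanishing_ideal_def q)
  moreover have "q \<notin> vanishing_ideal S" using p(2) r by (auto simp: vanishing_ideal_def q)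
  ultimately show ?thesis by (auto simp: subspace_closure_def spec_zero_set_def)
qed

text \<open>Strictness is witnessed by a linear form that is 0 on \<open>B\<close> and 1 on
  \<open>b\<close>, minus its value at \<open>p\<close>.\<close>

lemma vanishing_ideal_affine_psubset:
  fixes p :: "'k::field ^ 'm::finite"
  assumes B: "vec.independent (insert b B)" "b \<notin> B"
  shows "vanishing_ideal ((+) p ` vec.span (insert b B)) \<subset> vanishing_ideal ((+) p ` vec.span B)"
proof
  show "vanishing_ideal ((+) p ` vec.span (insert b B)) \<subseteq> vanishing_ideal ((+) p ` vec.span B)"
    using vec.span_mono[OF subset_insertI[of B b]] by (auto simp: vanishing_ideal_def)
  obtain f :: "'k ^ 'm \<Rightarrow> 'k ^ 'm" where f: "Vector_Spaces.linear (*s) (*s) f"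
    "\<And>x. x \<in> insert b B \<Longrightarrow> f x = (if x = b then 1 else 0)"
    using vec.linear_independent_extend[OF B(1), of "\<lambda>x. if x = b then 1 else 0"] by blast
  interpret f: Vector_Spaces.linear "(*s)" "(*s)" f by fact
  have fB: "f x = 0" if "x \<in> vec.span B" for x
    using that
    by (rule f.eq_0_on_span[rotated]) (use f(2) B(2) in auto)
  \<comment> \<open>Any coordinate serves, because \<open>f b\<close> is the all-ones
    vector.\<close>
  obtain r :: 'm where True by blast
  obtain q :: "('m, 'k) mpoly" where q: "\<And>v. meval (\<lambda>i. v $ i) q = f v $ r"
    using linear_form_mpoly[OF f(1)] by blast
  define h where "h = q - mconst (f p $ r)"
  have h: "meval (\<lambda>i. (p + v) $ i) h = f v $ r" for v
    using q[of "p + v"] by (simp add: h_def meval_diff f.add)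
  have "h \<in> vanishing_ideal ((+) p ` vec.span B)"
    using h fB unfolding vanishing_ideal_def by (auto simp del: vector_add_component)
  moreover have "h \<notin> vanishing_ideal ((+) p ` vec.span (insert b B))"
  proof
    assume "h \<in> vanishing_ideal ((+) p ` vec.span (insert b B))"
    moreover have "b \<in> vec.span (insert b B)" by (intro vec.span_base) simp
    ultimately have "meval (\<lambda>i. (p + b) $ i) h = 0" unfolding vanishing_ideal_def by blast
    then show False using f(2)[of b] unfolding h by simp
  qed
  ultimately show "vanishing_ideal ((+) p ` vec.span (insert b B)) \<noteq> vanishing_ideal ((+) p ` vec.span B)"
    by metis
qed

lemma meval_pencil_matrix:
  "meval (\<lambda>i. v $ i) (pencil_matrix A B $ i $ j) = (if j = 1 then (A *v v) $ i else (B *v v) $ i)"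
  by (simp add: pencil_matrix_def Let_def matrix_vector_mult_def meval_sum meval_mult)

text \<open>At every point of \<open>S\<close> the two columns are proportional, so all the minors
  vanish there.\<close>

lemma minors_ideal_vanishing:
  fixes A B :: "'k::field ^ 'm::finite ^ 'm"
  assumes I: "ideal (vanishing_ideal S) (mpoly_ring :: ('m, 'k) mpoly ring)"
    and S: "\<And>v. v \<in> S \<Longrightarrow> A *v v = c *s (B *v v)"
  shows "minors_ideal A B \<subseteq> vanishing_ideal S"
proof -
  have "ring (mpoly_ring :: ('m, 'k) mpoly ring)" ..
  moreover have "minors2 (pencil_matrix A B) \<subseteq> vanishing_ideal S"
    unfolding minors2_def vanishing_ideal_def
    by (auto simp: det_2 meval_diff meval_mult meval_pencil_matrix S)
  ultimately show ?thesis unfolding minors_ideal_def using ring.genideal_minimal I by blast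
qed

lemma krull_dim_U_locus_ge:
  fixes \<tau>1 \<tau>2 \<rho> :: "'k::field ^ 'm::finite \<Rightarrow> 'k ^ 'm"
  assumes inf: "infinite (UNIV :: 'k set)"
    and l1: "Vector_Spaces.linear (*s) (*s) \<tau>1" and l2: "Vector_Spaces.linear (*s) (*s) \<tau>2"
    and l\<rho>: "Vector_Spaces.linear (*s) (*s) \<rho>"
    and c: "c \<noteq> 0" "c \<noteq> 1" and p: "\<rho> (\<tau>1 p) = c *s \<tau>2 p" "\<tau>2 p \<noteq> 0"
  shows "ereal (real (vec.dim {v. \<rho> (\<tau>1 v) = c *s \<tau>2 v}))
    \<le> krull_dim (subtopology (Spec mpoly_ring) (U_locus \<rho> \<tau>1 \<tau>2))"
proof -
  interpret l1: Vector_Spaces.linear "(*s)" "(*s)" \<tau>1 by fact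
  interpret l2: Vector_Spaces.linear "(*s)" "(*s)" \<tau>2 by fact
  interpret l\<rho>: Vector_Spaces.linear "(*s)" "(*s)" \<rho> by fact
  let ?K = "{v. \<rho> (\<tau>1 v) = c *s \<tau>2 v}"
  have subK: "vec.subspace ?K"
    by (rule vec.subspaceI)
       (simp_all add: l1.add l2.add l\<rho>.add l1.scale l2.scale l\<rho>.scale vec.scale_right_distrib mult.commute)
  obtain B where B: "B \<subseteq> ?K" "vec.independent B" "card B = vec.dim ?K"
    by (rule vec.basis_exists[of ?K])
  have "finite B" using B(2) vec.finiteI_independent by blast
  then obtain bs where bs: "set bs = B" "distinct bs" using finite_distinct_list by blast
  have len: "length bs = vec.dim ?K" using bs B(3) distinct_card by metis
  \<comment> \<open>The flag is translated by \<open>p\<close> because the origin lies in the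
    removed kernels. It starts at the point \<open>p\<close> itself, so \<open>dim ?K\<close> basis
    vectors give a chain with \<open>dim ?K\<close> strict steps.\<close>
  define P where "P i = vanishing_ideal ((+) p ` vec.span (set (take i bs)))" for i
  have prime: "primeideal (P i) mpoly_ring" for i
    unfolding P_def by (intro primeideal_vanishing_ideal_affine[OF inf] vec.subspace_span)
  have pmem: "p \<in> (+) p ` vec.span (set (take i bs))" for i
    by (rule image_eqI[of _ _ 0]) (simp_all add: vec.span_zero)
  have lin\<rho>: "Vector_Spaces.linear (*s) (*s) (\<lambda>v. \<rho> (\<tau>1 v))"
    using Vector_Spaces.linear_compose[OF l1 l\<rho>] by (simp add: o_def)
  have lind: "Vector_Spaces.linear (*s) (*s) (\<lambda>v. \<rho> (\<tau>1 v) - \<tau>2 v)"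
    by unfold_locales (simp_all add: l1.add l2.add l\<rho>.add l1.scale l2.scale l\<rho>.scale algebra_simps)
  \<comment> \<open>The values of all three maps at \<open>p\<close> are nonzero multiples of
    \<open>\<tau>2 p\<close>, as \<open>c\<close> is neither 0 nor 1; hence no member of the flag
    lies in a removed kernel.\<close>
  have "\<rho> (\<tau>1 p) - \<tau>2 p = (c - 1) *s \<tau>2 p" using p(1) by (simp add: vec.scale_left_diff_distrib)
  then have nzd: "\<rho> (\<tau>1 p) - \<tau>2 p \<noteq> 0"
    using c p(2) by (metis right_minus_eq vec.scale_eq_0_iff)
  have nz\<rho>: "\<rho> (\<tau>1 p) \<noteq> 0" using c p by simp
  have PU: "P i \<in> U_locus \<rho> \<tau>1 \<tau>2" for i
  proof -
    have "minors_ideal (matrix \<rho> ** matrix \<tau>1) (matrix \<tau>2) \<subseteq> P i"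
      unfolding P_def
    proof (rule minors_ideal_vanishing)
      show "ideal (vanishing_ideal ((+) p ` vec.span (set (take i bs)))) mpoly_ring"
        using prime[of i] by (simp add: P_def primeideal_def)
      fix v assume "v \<in> (+) p ` vec.span (set (take i bs))"
      moreover have "vec.span (set (take i bs)) \<subseteq> ?K"
        using set_take_subset[of i bs] bs(1) B(1) by (intro vec.span_minimal subK) blast
      ultimately have "v \<in> ?K" using vec.subspace_add[OF subK, of p] p(1) by auto
      then show "(matrix \<rho> ** matrix \<tau>1) *v v = c *s (matrix \<tau>2 *v v)"
        by (simp add: matrix_works l1 l2 l\<rho> flip: matrix_vector_mul_assoc)
    qed
    then have "P i \<in> Y_locus \<rho> \<tau>1 \<tau>2"
      using prime by (simp add: Y_locus_def spec_zero_set_def prime_spectrum_def)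
    then show ?thesis
      unfolding U_locus_def
      using not_in_subspace_closure[OF lind nzd pmem] not_in_subspace_closure[OF lin\<rho> nz\<rho> pmem]
        not_in_subspace_closure[OF l2 p(2) pmem] unfolding P_def by blast
  qed
  have "P (Suc i) \<subset> P i" if i: "i < vec.dim ?K" for i
  proof -
    have eq: "set (take (Suc i) bs) = insert (bs ! i) (set (take i bs))"
      using i len by (simp add: take_Suc_conv_app_nth)
    have "vec.independent (set (take (Suc i) bs))"
      using vec.independent_mono[OF B(2)] set_take_subset[of "Suc i" bs] bs(1) by blast
    moreover have "bs ! i \<notin> set (take i bs)"
      using bs(2) i len by (auto simp: in_set_conv_nth nth_eq_iff_index_eq)
    ultimately show ?thesis unfolding P_def eq by (intro vanishing_ideal_affine_psubset)
  qed
  moreover have "U_locus \<rho> \<tau>1 \<tau>2 \<subseteq> prime_spectrum mpoly_ring"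
    by (auto simp: U_locus_def Y_locus_def spec_zero_set_def)
  ultimately show ?thesis
    by (intro krull_dim_ge_chain[where P = P] cring_from_type_algebra) (auto intro: PU)
qed

section \<open>Ranks in the pencil and the generic subspace\<close>

theorem theorem1p1:
  fixes \<tau>1 \<tau>2 \<rho> :: "'k::field ^ 'm::finite \<Rightarrow> 'k ^ 'm"
  assumes "infinite (UNIV :: 'k set)"
    and "2 * CARD('n::finite) \<le> CARD('m)"
    and "Vector_Spaces.linear (*s) (*s) \<tau>1"
    and "Vector_Spaces.linear (*s) (*s) \<tau>2"
    and "Vector_Spaces.linear (*s) (*s) \<rho>"
    and "\<rho> \<circ> \<rho> = \<rho>"
    and "range \<rho> = range \<tau>2"
    and "krull_dim (subtopology (Spec mpoly_ring) (U_locus \<rho> \<tau>1 \<tau>2))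
           \<le> ereal (real CARD('m) - real CARD('n))"
    and "vec.dim (range \<tau>2) \<ge> 2 * CARD('n)"
    and "vec.dim (range \<tau>1) \<ge> CARD('n)"
  shows "\<exists>\<U>. openin (Gr_zariski TYPE('n)) \<U> \<and>
           Gr_zariski TYPE('n) closure_of \<U> = Gr TYPE('n) \<and>
           (\<forall>V\<in>\<U>. \<forall>v1\<in>V. \<forall>v2\<in>V. \<tau>1 v1 = \<tau>2 v2 \<longrightarrow> v1 = v2)"
proof -
  note inf = assms(1) and l1 = assms(3) and l2 = assms(4) and l\<rho> = assms(5)
  interpret l1: Vector_Spaces.linear "(*s)" "(*s)" \<tau>1 by fact
  interpret l2: Vector_Spaces.linear "(*s)" "(*s)" \<tau>2 by fact
  interpret l\<rho>: Vector_Spaces.linear "(*s)" "(*s)" \<rho> by fact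
  have \<rho>2: "\<rho> (\<tau>2 v) = \<tau>2 v" for v
  proof -
    obtain u where "\<tau>2 v = \<rho> u" using assms(7) by (metis rangeE rangeI)
    then show ?thesis using assms(6) by (metis comp_apply)
  qed
  have r: "CARD('n) \<le> vec.dim (range (\<lambda>v. \<tau>1 v - c *s \<tau>2 v))" if c: "c \<noteq> 1" for c
  proof (cases "c = 0")
    case True
    then show ?thesis using assms(10) by simp
  next
    case False
    let ?f = "\<lambda>v. \<tau>1 v - c *s \<tau>2 v"
    let ?g = "\<lambda>v. \<rho> (\<tau>1 v) - c *s \<tau>2 v"
    have ling: "Vector_Spaces.linear (*s) (*s) ?g"
      by unfold_locales (simp_all add: l1.add l2.add l\<rho>.add l1.scale l2.scale l\<rho>.scale algebra_simps)
    \<comment> \<open>As \<open>\<rho>\<close> fixes the image of \<open>\<tau>2\<close>, the map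
      \<open>?g\<close> is \<open>?f\<close> followed by \<open>\<rho>\<close>, and a rank bound for
      \<open>?g\<close> passes to \<open>?f\<close>.\<close>
    have "?g v = \<rho> (?f v)" for v by (simp add: l\<rho>.diff l\<rho>.scale \<rho>2)
    then have "range ?g = \<rho> ` range ?f" by (simp only: image_image)
    then have le: "vec.dim (range ?g) \<le> vec.dim (range ?f)" using vec.dim_image_le[OF l\<rho>] by simp
    have "vec.dim {v. ?g v = 0} + CARD('n) \<le> CARD('m)"
    \<comment> \<open>Either the kernel lies in that of \<open>\<tau>2\<close>, of dimension at most
      \<open>m - 2 * n\<close>, or it has a point outside, and then the bound on the dimension of
      the locus applies.\<close>
    proof (cases "{v. ?g v = 0} \<subseteq> {v. \<tau>2 v = 0}")
      case True
      then have "vec.dim {v. ?g v = 0} \<le> vec.dim {v. \<tau>2 v = 0}" by (rule vec.dim_subset)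
      then show ?thesis using rank_nullity[OF l2] assms(9) by linarith
    next
      case nsub: False
      then obtain p where "\<rho> (\<tau>1 p) = c *s \<tau>2 p" "\<tau>2 p \<noteq> 0" by auto
      from krull_dim_U_locus_ge[OF inf l1 l2 l\<rho> False c this]
      have "ereal (real (vec.dim {v. \<rho> (\<tau>1 v) = c *s \<tau>2 v})) \<le> ereal (real CARD('m) - real CARD('n))"
        using assms(8) by (rule order_trans)
      then show ?thesis by simp
    qed
    then show ?thesis using rank_nullity[OF ling] le by linarith
  qed
  have "CARD('n) \<le> CARD('m)" using assms(2) by linarith
  from open_dense_avoiding_thin[OF inf this thin_failing_matrices[OF inf l1 l2 assms(9) r]]
  obtain \<U> :: "('k ^ 'm) set set" where U: "openin (Gr_zariski TYPE('n)) \<U>"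
    "Gr_zariski TYPE('n) closure_of \<U> = Gr TYPE('n)"
    "\<And>V. V \<in> \<U> \<Longrightarrow> \<exists>M :: 'm \<times> 'n \<Rightarrow> 'k. M \<notin> {M. \<exists>a b. a \<noteq> b \<and> \<tau>1 (comb M a) = \<tau>2 (comb M b)} \<and>
      V = range (comb M)" by blast
  have "v1 = v2" if "V \<in> \<U>" "v1 \<in> V" "v2 \<in> V" "\<tau>1 v1 = \<tau>2 v2" for V v1 v2
  proof -
    obtain M :: "'m \<times> 'n \<Rightarrow> 'k" where M: "\<And>a b. \<tau>1 (comb M a) = \<tau>2 (comb M b) \<Longrightarrow> a = b"
      "V = range (comb M)"
      using U(3)[OF \<open>V \<in> \<U>\<close>] by blast
    then obtain a b where "v1 = comb M a" "v2 = comb M b"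
      using \<open>v1 \<in> V\<close> \<open>v2 \<in> V\<close> by blast
    then show ?thesis using M(1)[of a b] \<open>\<tau>1 v1 = \<tau>2 v2\<close> by simp
  qed
  then show ?thesis using U(1,2) by blast
qed

end
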